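(* Let $q\in(0,1)$, $\nu>-1$ and $s\in\{2,3\}$. Then the radius of uniform convexity of $z\mapsto h_\nu^{(s)}(z;q)$ is the smallest positive root $r$ of the equation $$(\nu-1)(\nu-2)J_{\nu}^{(s)}(\sqrt{r};q)+(4-2\nu)\sqrt{r}\,\big(J_{\nu}^{(s)}\big)^{\prime}(\sqrt{r};q)+r\,\big(J_{\nu}^{(s)}\big)^{\prime\prime}(\sqrt{r};q)=0,$$ where $\big(J_{\nu}^{(s)}\big)^{\prime}$ and $\big(J_{\nu}^{(s)}\big)^{\prime\prime}$ denote the first and second derivatives of $w\mapsto J_\nu^{(s)}(w;q)$, evaluated at $w=\sqrt r$.
   Context: For $a\in\mathbb{C}$ and $q\in(0,1)$ let $(a;q)_0=1$, $(a;q)_n=\prod_{k=1}^{n}(1-aq^{k-1})$, $(a;q)_\infty=\prod_{k\ge1}(1-aq^{k-1})$. For $\nu>-1$, Jackson's second and third (Hahn–Exton) $q$-Bessel functions are $$J_{\nu}^{(2)}(z;q)=\frac{(q^{\nu+1};q)_{\infty}}{(q;q)_{\infty}}\sum_{n\geq0}\frac{(-1)^{n}(z/2)^{2n+\nu}}{(q;q)_{n}(q^{\nu+1};q)_{n}}q^{n(n+\nu)},\qquad J_{\nu}^{(3)}(z;q)=\frac{(q^{\nu+1};q)_{\infty}}{(q;q)_{\infty}}\sum_{n\geq0}\frac{(-1)^{n}z^{2n+\nu}}{(q;q)_{n}(q^{\nu+1};q)_{n}}q^{n(n+1)/2}.$$ Let $c_\nu(q)=(q;q)_\infty/(q^{\nu+1};q)_\infty$.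 Define $h_\nu^{(2)}(z;q)=2^\nu c_\nu(q)z^{1-\nu/2}J_\nu^{(2)}(\sqrt z;q)$ and $h_\nu^{(3)}(z;q)=c_\nu(q)z^{1-\nu/2}J_\nu^{(3)}(\sqrt z;q)$ (these are entire functions of $z$ with $h(0)=0$, $h'(0)=1$). For an analytic function $f$ with $f(0)=0,f'(0)=1$, its radius of uniform convexity is $r^{uc}(f)=\sup\{r>0: f \text{ is analytic on } \mathbb{D}_r,\ f'\neq0 \text{ on } \mathbb{D}_r, \text{ and } \Re\big(1+\tfrac{zf''(z)}{f'(z)}\big)>\big|\tfrac{zf''(z)}{f'(z)}\big| \text{ for all } z\in\mathbb{D}_r\}$, where $\mathbb{D}_r=\{z\in\mathbb{C}:|z|<r\}$. *)

theory Defs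
  imports "HOL-Analysis.Analysis"
begin

definition qpoch :: "real \<Rightarrow> real \<Rightarrow> nat \<Rightarrow> real" where
  "qpoch a q n = (\<Prod>k<n. 1 - a * q ^ k)"

definition qpoch_inf :: "real \<Rightarrow> real \<Rightarrow> real" where
  "qpoch_inf a q = prodinf (\<lambda>k. 1 - a * q ^ k)"

definition jackson2 :: "real \<Rightarrow> real \<Rightarrow> complex \<Rightarrow> complex" where
  "jackson2 \<nu> q w =
     of_real (qpoch_inf (q powr (\<nu> + 1)) q / qpoch_inf q q) *
     (\<Sum>n. (-1) ^ n * (w / 2) powr of_real (2 * real n + \<nu>) *
           of_real (q powr (real n * (real n + \<nu>)) /
                    (qpoch q q n * qpoch (q powr (\<nu> + 1)) q n)))"

definition jackson3 :: "real \<Rightarrow> real \<Rightarrow> complex \<Rightarrow> complex" where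
  "jackson3 \<nu> q w =
     of_real (qpoch_inf (q powr (\<nu> + 1)) q / qpoch_inf q q) *
     (\<Sum>n. (-1) ^ n * w powr of_real (2 * real n + \<nu>) *
           of_real (q powr (real n * (real n + 1) / 2) /
                    (qpoch q q n * qpoch (q powr (\<nu> + 1)) q n)))"

definition qJ :: "nat \<Rightarrow> real \<Rightarrow> real \<Rightarrow> complex \<Rightarrow> complex" where
  "qJ s \<nu> q = (if s = 2 then jackson2 \<nu> q else jackson3 \<nu> q)"

definition qc :: "real \<Rightarrow> real \<Rightarrow> real" where
  "qc \<nu> q = qpoch_inf q q / qpoch_inf (q powr (\<nu> + 1)) q"

definition qh :: "nat \<Rightarrow> real \<Rightarrow> real \<Rightarrow> complex \<Rightarrow> complex" where
  "qh s \<nu> q z =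
     (if s = 2 then of_real (2 powr \<nu>) else 1) * of_real (qc \<nu> q) *
     z powr of_real (1 - \<nu> / 2) * qJ s \<nu> q (csqrt z)"

definition radius_uc :: "(complex \<Rightarrow> complex) \<Rightarrow> ereal" where
  "radius_uc f = Sup (ereal ` {r. r > 0 \<and> f analytic_on ball 0 r \<and>
      (\<forall>z\<in>ball 0 r. deriv f z \<noteq> 0 \<and>
         cmod (z * deriv (deriv f) z / deriv f z) <
           Re (1 + z * deriv (deriv f) z / deriv f z))})"

end

theory Submission
  imports Defs "HOL-Complex_Analysis.Complex_Analysis" "HOL-Real_Asymp.Real_Asymp"
begin

text \<open>
  Write \<open>h(z) = z g(z)\<close> for the normalised Bessel function, a power series in \<open>z\<close>, and \<open>F = h'\<close>. Since
  \<open>J(w)\<close> is a constant multiple of \<open>w\<^sup>\<nu>\<^sup>-\<^sup>2 h(w\<^sup>2)\<close>, the equation of the theorem says \<open>F(r) + 2 r F'(r) = 0\<close>,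
  that is \<open>- r F'(r) / F(r) = 1/2\<close>. The key fact is that \<open>- F'/F\<close> has nonnegative Taylor coefficients.
  Then \<open>|z F'(z) / F(z)|\<close> is at most its value \<open>u(|z|)\<close> at the point \<open>|z|\<close>, the function \<open>u\<close> increases strictly,
  and the uniform convexity condition at a point with \<open>|w| < 1/2\<close>, \<open>w = z F'/F\<close>, holds because
  \<open>Re (1 + w) \<ge> 1 - |w| > |w|\<close>, while it fails at \<open>w = - 1/2\<close>.

  Nonnegativity is inherited by coefficientwise limits and holds for polynomials with positive zeros.
  Starting from \<open>\<Prod>i<N. 1 - q\<^sup>i\<^sup>+\<^sup>1 x\<close>, the operators \<open>p(x) \<mapsto> (p(x) - a p(Qx)) / (1 - a)\<close> with \<open>0 < a < 1\<close> keep
  the zeros positive provided that consecutive zeros have ratio at least \<open>1/Q\<close>, a property that they also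
  preserve. They multiply the \<open>n\<close>-th coefficient by \<open>(1 - a Q\<^sup>n) / (1 - a)\<close>. With \<open>Q = q\<close> they produce the factor
  \<open>1 / (q\<^sup>\<nu>\<^sup>+\<^sup>1; q)\<^sub>n\<close>; as \<open>Q \<rightarrow> 1\<close> they produce the Gaussian factor that separates \<open>s = 2\<close> from \<open>s = 3\<close>
  and the factor \<open>n + 1\<close> of the derivative.
\<close>

subsection \<open>Power series with nonnegative negated logarithmic derivative\<close>

definition neg_logderiv :: "real fps \<Rightarrow> real fps" where
  "neg_logderiv f = - fps_deriv f * inverse f"

text \<open>Constant term 1 is built in: it makes \<open>f\<close> invertible and keeps the
  recursion for the coefficients of -f'/f free of division, which the passage to limits
  exploits.\<close>

definition nonneg_logderiv :: "real fps \<Rightarrow> bool" where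
  "nonneg_logderiv f \<longleftrightarrow> fps_nth f 0 = 1 \<and> (\<forall>n. 0 \<le> fps_nth (neg_logderiv f) n)"

lemma neg_logderiv_mult_self:
  assumes "fps_nth f 0 = 1"
  shows "neg_logderiv f * f = - fps_deriv f"
  using assms by (simp add: neg_logderiv_def mult.assoc inverse_mult_eq_1)

text \<open>Compare coefficients in \<open>neg_logderiv_mult_self\<close> and solve for the last
  term, whose second factor is \<open>fps_nth f 0\<close>.\<close>

lemma neg_logderiv_nth:
  assumes "fps_nth f 0 = 1"
  shows "fps_nth (neg_logderiv f) n =
    - real (Suc n) * fps_nth f (Suc n) - (\<Sum>k<n. fps_nth (neg_logderiv f) k * fps_nth f (n - k))"
proof -
  have "fps_nth (neg_logderiv f * f) n = - real (Suc n) * fps_nth f (Suc n)"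
    unfolding neg_logderiv_mult_self[OF assms] by (simp add: algebra_simps)
  moreover have "fps_nth (neg_logderiv f * f) n =
      (\<Sum>k<n. fps_nth (neg_logderiv f) k * fps_nth f (n - k)) + fps_nth (neg_logderiv f) n"
    using assms by (simp add: fps_mult_nth atLeast0AtMost flip: lessThan_Suc_atMost)
  ultimately show ?thesis by simp
qed

lemma neg_logderiv_mult:
  assumes "fps_nth f 0 = 1" "fps_nth g 0 = 1"
  shows "neg_logderiv (f * g) = neg_logderiv f + neg_logderiv g"
proof -
  have "neg_logderiv (f * g) = - (fps_deriv f * g + f * fps_deriv g) * (inverse f * inverse g)"
    by (simp add: neg_logderiv_def fps_inverse_mult)
  also have "\<dots> = - fps_deriv f * inverse f * (g * inverse g) - fps_deriv g * inverse g * (f * inverse f)"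
    by (simp add: algebra_simps)
  finally show ?thesis
    using assms by (simp add: neg_logderiv_def inverse_mult_eq_1')
qed

lemma nonneg_logderiv_mult:
  "nonneg_logderiv f \<Longrightarrow> nonneg_logderiv g \<Longrightarrow> nonneg_logderiv (f * g)"
  by (simp add: nonneg_logderiv_def neg_logderiv_mult)

lemma nonneg_logderiv_1: "nonneg_logderiv 1"
  by (simp add: nonneg_logderiv_def neg_logderiv_def)

text \<open>The negated logarithmic derivative is the geometric series of b / (1 - b x).\<close>

lemma nonneg_logderiv_linear:
  assumes "0 \<le> b"
  shows "nonneg_logderiv (1 - fps_const b * fps_X)"
proof -
  let ?f = "1 - fps_const b * fps_X :: real fps"
  have "fps_nth (neg_logderiv ?f) n = b ^ Suc n" for n
  proof (induction n rule: less_induct)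
    case (less n)
    have 0: "fps_nth ?f 0 = 1" by simp
    \<comment> \<open>Since \<open>?f\<close> has degree at most 1, only k = n - 1 contributes; for
      n = 0 the sum is empty, so the truncated n - 1 does no harm.\<close>
    have "(\<Sum>k<n. fps_nth (neg_logderiv ?f) k * fps_nth ?f (n - k))
        = (\<Sum>k<n. b ^ Suc k * (if k = n - 1 then - b else 0))"
      using less by (intro sum.cong) auto
    also have "\<dots> = (if n = 0 then 0 else - (b ^ Suc n))"
    proof (cases n)
      case (Suc m)
      have "(\<Sum>k<Suc m. b ^ Suc k * (if k = m then - b else 0)) = b ^ Suc m * (- b)"
        by (subst sum.remove[of _ m]) (auto intro!: sum.neutral)
      with Suc show ?thesis by simp
    qed simp
    finally have s: "(\<Sum>k<n. fps_nth (neg_logderiv ?f) k * fps_nth ?f (n - k))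
      = (if n = 0 then 0 else - (b ^ Suc n))" .
    show ?case by (subst neg_logderiv_nth[OF 0], subst s, cases n) auto
  qed
  with assms show ?thesis by (simp add: nonneg_logderiv_def)
qed

text \<open>By the recursion each coefficient of -f'/f is a polynomial in finitely many coefficients
  of f, so it converges too, and weak inequalities survive limits.\<close>

lemma nonneg_logderiv_limit:
  assumes K: "eventually (\<lambda>j. nonneg_logderiv (f j)) F" and "F \<noteq> bot"
    and lim: "\<And>n. ((\<lambda>j. fps_nth (f j) n) \<longlongrightarrow> fps_nth g n) F"
  shows "nonneg_logderiv g"
proof -
  have one: "eventually (\<lambda>j. fps_nth (f j) 0 = 1) F"
    using K by eventually_elim (simp add: nonneg_logderiv_def)
  hence "((\<lambda>j. fps_nth (f j) 0) \<longlongrightarrow> 1) F"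
    by (rule tendsto_eventually)
  with lim[of 0] have g0: "fps_nth g 0 = 1"
    using \<open>F \<noteq> bot\<close> tendsto_unique by blast
  have L: "((\<lambda>j. fps_nth (neg_logderiv (f j)) n) \<longlongrightarrow> fps_nth (neg_logderiv g) n) F" for n
  proof (induction n rule: less_induct)
    case (less n)
    have "((\<lambda>j. - real (Suc n) * fps_nth (f j) (Suc n)
            - (\<Sum>k<n. fps_nth (neg_logderiv (f j)) k * fps_nth (f j) (n - k))) \<longlongrightarrow>
          - real (Suc n) * fps_nth g (Suc n)
            - (\<Sum>k<n. fps_nth (neg_logderiv g) k * fps_nth g (n - k))) F"
      by (intro tendsto_intros lim less) auto
    hence "((\<lambda>j. - real (Suc n) * fps_nth (f j) (Suc n)
            - (\<Sum>k<n. fps_nth (neg_logderiv (f j)) k * fps_nth (f j) (n - k))) \<longlongrightarrow>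
          fps_nth (neg_logderiv g) n) F"
      unfolding neg_logderiv_nth[OF g0, symmetric] .
    \<comment> \<open>The recursion holds for \<open>f j\<close> only once its constant term is 1,
      hence eventually.\<close>
    thus ?case
      by (rule Lim_transform_eventually)
         (use one in eventually_elim, rule neg_logderiv_nth [symmetric], simp)
  qed
  have "0 \<le> fps_nth (neg_logderiv g) n" for n
    using K by (intro tendsto_lowerbound[OF L _ \<open>F \<noteq> bot\<close>])
      (auto simp: nonneg_logderiv_def elim: eventually_mono)
  with g0 show ?thesis by (simp add: nonneg_logderiv_def)
qed

subsection \<open>Polynomials with separated positive zeros\<close>

text \<open>For q < 1 the zeros are listed in increasing order, and every factor is 1 at 0. Equality
  in the separation is allowed and occurs for \<open>euler_poly\<close>.\<close>

definition qsep_poly :: "real \<Rightarrow> nat \<Rightarrow> real poly \<Rightarrow> bool" where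
  "qsep_poly q N p \<longleftrightarrow> (\<exists>\<alpha>. (\<forall>i<N. 0 < \<alpha> i) \<and> (\<forall>i. Suc i < N \<longrightarrow> \<alpha> i \<le> q * \<alpha> (Suc i)) \<and>
     p = (\<Prod>i<N. [:1, - 1 / \<alpha> i:]))"

text \<open>Lets polynomials separated with a fixed q enter the operators whose parameter tends to
  1.\<close>

lemma qsep_poly_mono:
  assumes "qsep_poly q N p" "q \<le> q'"
  shows "qsep_poly q' N p"
proof -
  obtain \<alpha> where \<alpha>: "\<And>i. i < N \<Longrightarrow> 0 < \<alpha> i" "\<And>i. Suc i < N \<Longrightarrow> \<alpha> i \<le> q * \<alpha> (Suc i)"
    "p = (\<Prod>i<N. [:1, - 1 / \<alpha> i:])"
    using assms(1) unfolding qsep_poly_def by blast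
  have "\<alpha> i \<le> q' * \<alpha> (Suc i)" if "Suc i < N" for i
    using \<alpha>(2)[OF that] \<alpha>(1)[OF that] mult_right_mono[OF assms(2), of "\<alpha> (Suc i)"] by linarith
  with \<alpha> show ?thesis unfolding qsep_poly_def by blast
qed

lemma qsep_poly_nonneg_logderiv:
  assumes "qsep_poly q N p"
  shows "nonneg_logderiv (fps_of_poly p)"
proof -
  obtain \<alpha> where \<alpha>: "\<And>i. i < N \<Longrightarrow> 0 < \<alpha> i" "p = (\<Prod>i<N. [:1, - 1 / \<alpha> i:])"
    using assms unfolding qsep_poly_def by blast
  have "nonneg_logderiv (fps_of_poly (\<Prod>i<k. [:1, - 1 / \<alpha> i:]))" if "k \<le> N" for k
    using that
  proof (induction k)
    case (Suc k)
    have "fps_of_poly [:1, - 1 / \<alpha> k:] = 1 - fps_const (1 / \<alpha> k) * fps_X"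
      by (rule fps_ext) (auto simp: coeff_pCons split: nat.splits)
    moreover have "0 \<le> 1 / \<alpha> k" using \<alpha>(1)[of k] Suc.prems by simp
    ultimately show ?case
      using Suc by (simp only: prod.lessThan_Suc fps_of_poly_mult) (simp add: nonneg_logderiv_mult nonneg_logderiv_linear)
  qed (simp add: nonneg_logderiv_1)
  with \<alpha>(2) show ?thesis by blast
qed

text \<open>All zeros are divided by c, so their ratios stay the same.\<close>

lemma qsep_poly_scale:
  assumes "qsep_poly q N p" "0 < c"
  shows "qsep_poly q N (p \<circ>\<^sub>p [:0, c:])"
proof -
  obtain \<alpha> where \<alpha>: "\<And>i. i < N \<Longrightarrow> 0 < \<alpha> i" "\<And>i. Suc i < N \<Longrightarrow> \<alpha> i \<le> q * \<alpha> (Suc i)"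
    "p = (\<Prod>i<N. [:1, - 1 / \<alpha> i:])"
    using assms(1) unfolding qsep_poly_def by blast
  show ?thesis unfolding qsep_poly_def
  proof (intro exI[of _ "\<lambda>i. \<alpha> i / c"] conjI allI impI)
    show "p \<circ>\<^sub>p [:0, c:] = (\<Prod>i<N. [:1, - 1 / (\<alpha> i / c):])"
      by (simp add: \<alpha>(3) pcompose_prod pcompose_pCons)
  qed (use \<alpha> assms(2) in \<open>auto simp: divide_right_mono\<close>)
qed

lemma sep_chain:
  fixes \<alpha> :: "nat \<Rightarrow> real"
  assumes pos: "\<And>i. i < N \<Longrightarrow> 0 < \<alpha> i" and step: "\<And>i. Suc i < N \<Longrightarrow> \<alpha> i \<le> q * \<alpha> (Suc i)"
    and "0 < q" "q < 1" "i < j" "j < N"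
  shows "\<alpha> i \<le> q * \<alpha> j"
  using \<open>i < j\<close> \<open>j < N\<close>
proof (induction j)
  case (Suc j)
  show ?case
  proof (cases "i = j")
    case True
    with step Suc.prems show ?thesis by simp
  next
    case False
    hence "\<alpha> i \<le> q * \<alpha> j" using Suc by simp
    also have "\<dots> \<le> \<alpha> j" using pos[of j] Suc.prems \<open>q < 1\<close> by (simp add: mult_le_cancel_right1)
    also have "\<dots> \<le> q * \<alpha> (Suc j)" using step Suc.prems by simp
    finally show ?thesis .
  qed
qed simp

text \<open>Used for the sign of p at a point lying weakly between two neighbouring zeros.\<close>

lemma sgn_prod_split:
  fixes f :: "nat \<Rightarrow> real"
  assumes "\<And>j. j < k \<Longrightarrow> f j \<le> 0" "\<And>j. k \<le> j \<Longrightarrow> j < N \<Longrightarrow> 0 \<le> f j" "k \<le> N"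
  shows "0 \<le> (-1) ^ k * (\<Prod>j<N. f j)"
proof -
  have "(\<Prod>j<N. f j) = (\<Prod>j<k. f j) * (\<Prod>j=k..<N. f j)"
    using \<open>k \<le> N\<close> by (metis prod.atLeastLessThan_concat lessThan_atLeast0 le0)
  moreover have "(-1) ^ k * (\<Prod>j<k. f j) = (\<Prod>j<k. - f j)"
    by (simp add: prod_uminus)
  ultimately have "(-1) ^ k * (\<Prod>j<N. f j) = (\<Prod>j<k. - f j) * (\<Prod>j=k..<N. f j)"
    by simp
  also have "0 \<le> \<dots>"
    using assms by (intro mult_nonneg_nonneg prod_nonneg) auto
  finally show ?thesis .
qed

lemma poly_IVT_weak:
  fixes f :: "real poly"
  assumes "l \<le> r" "poly f l * poly f r \<le> 0"
  shows "\<exists>x. l \<le> x \<and> x \<le> r \<and> poly f x = 0"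
proof -
  have c: "continuous_on {l..r} (poly f)" by (intro continuous_intros)
  have "(poly f l \<le> 0 \<and> 0 \<le> poly f r) \<or> (poly f r \<le> 0 \<and> 0 \<le> poly f l)"
    using assms(2) by (auto simp: mult_le_0_iff)
  thus ?thesis
    using IVT'[OF _ _ assms(1) c] IVT2'[OF _ _ assms(1) c] by blast
qed

text \<open>The difference of the two sides has degree at most N but the N + 1 distinct zeros 0 and
  \<beta> i.\<close>

lemma poly_eq_prod_roots:
  fixes f :: "real poly"
  assumes "degree f \<le> N" "poly f 0 = 1" "inj_on \<beta> {..<N}" "\<And>i. i < N \<Longrightarrow> poly f (\<beta> i) = 0"
  shows "f = (\<Prod>i<N. [:1, - 1 / \<beta> i:])"
proof -
  let ?g = "\<Prod>i<N. [:1, - 1 / \<beta> i:]"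
  have nz: "\<beta> i \<noteq> 0" if "i < N" for i using assms(2) assms(4)[OF that] by auto
  have "degree ?g \<le> sum (degree \<circ> (\<lambda>i. [:1, - 1 / \<beta> i:])) {..<N}"
    by (rule degree_prod_sum_le) simp
  also have "\<dots> \<le> sum (\<lambda>_. 1) {..<N}" by (intro sum_mono) simp
  finally have dg: "degree ?g \<le> N" by simp
  have "f - ?g = 0"
  proof (rule ccontr)
    assume "f - ?g \<noteq> 0"
    have "insert 0 (\<beta> ` {..<N}) \<subseteq> {x. poly (f - ?g) x = 0}"
    proof -
      have "poly ?g (\<beta> i) = 0" if "i < N" for i
        using that nz[OF that] by (auto simp: poly_prod)
      moreover have "poly ?g 0 = 1" by (simp add: poly_prod)
      ultimately show ?thesis using assms by auto
    qed
    hence "card (insert 0 (\<beta> ` {..<N})) \<le> card {x. poly (f - ?g) x = 0}"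
      using poly_roots_finite[OF \<open>f - ?g \<noteq> 0\<close>] by (intro card_mono)
    also have "\<dots> \<le> degree (f - ?g)" using card_poly_roots_bound[OF \<open>f - ?g \<noteq> 0\<close>] .
    also have "\<dots> \<le> N" using assms(1) dg by (rule degree_diff_le)
    finally have "card (insert 0 (\<beta> ` {..<N})) \<le> N" .
    moreover have "0 \<notin> \<beta> ` {..<N}" using nz by force
    ultimately show False using card_image[OF assms(3)] by simp
  qed
  thus ?thesis by simp
qed

section \<open>The q-difference operators\<close>

definition qdiff_poly :: "real \<Rightarrow> real \<Rightarrow> real poly \<Rightarrow> real poly" where
  "qdiff_poly q a p = smult (1 / (1 - a)) (p - smult a (p \<circ>\<^sub>p [:0, q:]))"

lemma coeff_pcompose_scale: "coeff (p \<circ>\<^sub>p [:0, c:]) n = coeff p n * (c :: real) ^ n"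
proof (induction p arbitrary: n)
  case (pCons a p)
  thus ?case by (cases n) (auto simp: pcompose_pCons coeff_pCons)
qed simp

text \<open>Dividing by 1 - a keeps the constant term. For a = q the multiplier is 1 + q + ... +
  q^n, so the operator is then the q-analogue of the derivative of x p(x).\<close>

lemma coeff_qdiff_poly: "coeff (qdiff_poly q a p) n = coeff p n * ((1 - a * q ^ n) / (1 - a))"
  by (simp add: qdiff_poly_def coeff_pcompose_scale right_diff_distrib diff_divide_distrib mult.left_commute)

lemma poly_qdiff_poly: "poly (qdiff_poly q a p) x = (poly p x - a * poly p (q * x)) / (1 - a)"
  by (simp add: qdiff_poly_def poly_pcompose mult.commute)

text \<open>
  The new zeros are located by sign changes: \<open>p(x) - a p(qx)\<close> has opposite weak signs at \<open>\<alpha>\<^sub>i\<^sub>-\<^sub>1 / q\<close>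
  (at \<open>0\<close> if \<open>i = 0\<close>) and at \<open>\<alpha>\<^sub>i\<close>, and these intervals are themselves separated by the factor \<open>1/q\<close>.
\<close>

lemma qsep_poly_qdiff:
  assumes "qsep_poly q N p" and q: "0 < q" "q < 1" and a: "0 < a" "a < 1"
  shows "qsep_poly q N (qdiff_poly q a p)"
proof -
  obtain \<alpha> where pos: "\<And>i. i < N \<Longrightarrow> 0 < \<alpha> i" and step: "\<And>i. Suc i < N \<Longrightarrow> \<alpha> i \<le> q * \<alpha> (Suc i)"
    and p: "p = (\<Prod>i<N. [:1, - 1 / \<alpha> i:])"
    using assms(1) unfolding qsep_poly_def by blast
  have chain: "\<alpha> i \<le> q * \<alpha> j" if "i < j" "j < N" for i j
    using sep_chain[of N \<alpha> q i j] pos step q that by blast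
  have poly_p: "poly p x = (\<Prod>j<N. 1 - x / \<alpha> j)" for x
    by (simp add: p poly_prod)
  let ?f = "qdiff_poly q a p"
  have p0: "poly p 0 = 1" by (simp add: poly_p)
  hence f0: "poly ?f 0 = 1" using a by (simp add: poly_qdiff_poly)
  have mono: "\<alpha> i \<le> \<alpha> j" if "i \<le> j" "j < N" for i j
  proof (cases "i = j")
    case False
    hence "\<alpha> i \<le> q * \<alpha> j" using chain[of i j] that by simp
    also have "\<dots> \<le> 1 * \<alpha> j" using pos[of j] that q by (intro mult_right_mono) auto
    finally show ?thesis by simp
  qed simp
  have pz: "poly p (\<alpha> i) = 0" if "i < N" for i
    unfolding poly_p using that pos[OF that] by (intro prod_zero bexI[of _ i]) auto
  \<comment> \<open>At \<alpha> i only the term with p(q \<alpha> i) survives, and by the separation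
    q \<alpha> i lies weakly between \<alpha> (i - 1) and \<alpha> i.\<close>
  have right: "0 \<le> (-1) ^ Suc i * poly ?f (\<alpha> i)" if "i < N" for i
  proof -
    have "0 \<le> (-1) ^ i * poly p (q * \<alpha> i)"
      unfolding poly_p
    proof (rule sgn_prod_split)
      fix j assume "j < i"
      thus "1 - q * \<alpha> i / \<alpha> j \<le> 0" using chain[of j i] pos[of j] that by simp
    next
      fix j assume "i \<le> j" "j < N"
      have "q * \<alpha> i \<le> \<alpha> i" using pos[OF that] q by simp
      also have "\<dots> \<le> \<alpha> j" using mono \<open>i \<le> j\<close> \<open>j < N\<close> by simp
      finally show "0 \<le> 1 - q * \<alpha> i / \<alpha> j" using pos[of j] \<open>j < N\<close> by simp
    qed (use that in simp)
    moreover have "(-1) ^ Suc i * poly ?f (\<alpha> i) = a / (1 - a) * ((-1) ^ i * poly p (q * \<alpha> i))"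
      using pz[OF that] by (simp add: poly_qdiff_poly)
    ultimately show ?thesis using a by simp
  qed
  \<comment> \<open>At \<alpha> i / q the other term survives; this point lies weakly between
    \<alpha> i and \<alpha> (i + 1).\<close>
  have left: "0 \<le> (-1) ^ Suc i * poly ?f (\<alpha> i / q)" if "i < N" for i
  proof -
    have "0 \<le> (-1) ^ Suc i * poly p (\<alpha> i / q)"
      unfolding poly_p
    proof (rule sgn_prod_split)
      fix j assume "j < Suc i"
      hence "q * \<alpha> j \<le> \<alpha> j" "\<alpha> j \<le> \<alpha> i" using pos[of j] q mono[of j i] that by auto
      hence "q * \<alpha> j \<le> \<alpha> i" by linarith
      thus "1 - \<alpha> i / q / \<alpha> j \<le> 0" using pos[of j] that q \<open>j < Suc i\<close> by (simp add: field_simps)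
    next
      fix j assume "Suc i \<le> j" "j < N"
      thus "0 \<le> 1 - \<alpha> i / q / \<alpha> j" using chain[of i j] pos[of j] q by (simp add: field_simps)
    qed (use that in simp)
    moreover have "poly ?f (\<alpha> i / q) = poly p (\<alpha> i / q) / (1 - a)"
      using pz[OF that] q by (simp add: poly_qdiff_poly)
    ultimately have "(-1) ^ Suc i * poly ?f (\<alpha> i / q) = ((-1) ^ Suc i * poly p (\<alpha> i / q)) / (1 - a)"
      by simp
    thus ?thesis using \<open>0 \<le> (-1) ^ Suc i * poly p (\<alpha> i / q)\<close> a
      by (simp del: power_Suc)
  qed
  \<comment> \<open>Left ends of the search intervals. The first one is 0, where \<open>f0\<close>
    supplies the sign.\<close>
  define lo where "lo i = (case i of 0 \<Rightarrow> 0 | Suc k \<Rightarrow> \<alpha> k / q)" for i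
  have lo_le: "lo i \<le> \<alpha> i" if "i < N" for i
    using that step pos[of i] q by (cases i) (auto simp: lo_def field_simps)
  have "\<exists>x. lo i \<le> x \<and> x \<le> \<alpha> i \<and> poly ?f x = 0" if "i < N" for i
  proof (rule poly_IVT_weak[OF lo_le[OF that]])
    have "0 \<le> (-1) ^ i * poly ?f (lo i)"
      using that left[of "i - 1"] f0 by (cases i) (auto simp: lo_def)
    hence "0 \<le> ((-1) ^ i * poly ?f (lo i)) * ((-1) ^ Suc i * poly ?f (\<alpha> i))"
      using right[OF that] by (rule mult_nonneg_nonneg)
    also have "\<dots> = - ((-1) ^ i * (-1) ^ i * (poly ?f (lo i) * poly ?f (\<alpha> i)))" by simp
    also have "(-1) ^ i * (-1) ^ i = (1 :: real)" by (simp flip: power_mult_distrib)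
    finally show "poly ?f (lo i) * poly ?f (\<alpha> i) \<le> 0" by simp
  qed
  then obtain \<beta> where \<beta>: "\<And>i. i < N \<Longrightarrow> lo i \<le> \<beta> i" "\<And>i. i < N \<Longrightarrow> \<beta> i \<le> \<alpha> i"
    "\<And>i. i < N \<Longrightarrow> poly ?f (\<beta> i) = 0"
    by metis
  have \<beta>_pos: "0 < \<beta> i" if "i < N" for i
  proof -
    have "0 \<le> lo i" using pos that q by (cases i) (auto simp: lo_def less_imp_le)
    with \<beta>(1)[OF that] have "0 \<le> \<beta> i" by simp
    moreover have "\<beta> i \<noteq> 0" using \<beta>(3)[OF that] f0 by auto
    ultimately show ?thesis by simp
  qed
  \<comment> \<open>The intervals alone give this: \<beta> i is at most \<alpha> i, which is q times
    the left end of the next interval.\<close>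
  have \<beta>_step: "\<beta> i \<le> q * \<beta> (Suc i)" if "Suc i < N" for i
    using \<beta>(2)[of i] \<beta>(1)[of "Suc i"] that q by (simp add: lo_def field_simps)
  have "inj_on \<beta> {..<N}"
  proof (rule linorder_inj_onI')
    fix i j assume "i \<in> {..<N}" "j \<in> {..<N}" "i < j"
    hence "\<beta> i \<le> q * \<beta> j" "0 < \<beta> j"
      using sep_chain[of N \<beta> q i j] \<beta>_pos \<beta>_step q by auto
    have "q * \<beta> j < 1 * \<beta> j" using \<open>0 < \<beta> j\<close> q by (intro mult_strict_right_mono) auto
    with \<open>\<beta> i \<le> q * \<beta> j\<close> show "\<beta> i \<noteq> \<beta> j" by simp
  qed
  moreover have "degree ?f \<le> N"
  proof -
    have "degree p \<le> sum (degree \<circ> (\<lambda>i. [:1, - 1 / \<alpha> i:])) {..<N}"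
      unfolding p by (rule degree_prod_sum_le) simp
    also have "\<dots> \<le> sum (\<lambda>_. 1) {..<N}" by (intro sum_mono) simp
    finally have "degree p \<le> N" by simp
    thus ?thesis by (intro degree_le) (auto simp: coeff_qdiff_poly coeff_eq_0)
  qed
  ultimately have "?f = (\<Prod>i<N. [:1, - 1 / \<beta> i:])"
    using f0 \<beta>(3) by (intro poly_eq_prod_roots) auto
  with \<beta>_pos \<beta>_step show ?thesis unfolding qsep_poly_def by blast
qed

subsection \<open>Passage to the limit\<close>

lemma gauss_limit_real:
  "((\<lambda>x::real. x\<^sup>2 * ln (2 * exp (- (1 / x)) - exp (- (2 / x)))) \<longlongrightarrow> -1) at_top"
  by real_asymp

text \<open>With \<open>y = exp (- t / sqrt M)\<close> the base is \<open>1 - (1 - y)\<^sup>2\<close>, where \<open>(1 - y)\<^sup>2\<close> is close to \<open>t\<^sup>2 / M\<close>.\<close>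

lemma gauss_limit:
  fixes t :: real
  assumes "t \<ge> 0"
  shows "(\<lambda>M::nat. (2 * exp (- t / sqrt (real M)) - exp (- 2 * t / sqrt (real M))) ^ M) \<longlonglongrightarrow> exp (- t\<^sup>2)"
proof (cases "t = 0")
  case False
  with assms have t: "t > 0" by simp
  let ?g = "\<lambda>x::real. 2 * exp (- (1 / x)) - exp (- (2 / x))"
  \<comment> \<open>With x = sqrt M / t the exponent M equals (t x)^2, which reduces the claim to
    \<open>gauss_limit_real\<close>.\<close>
  have "filterlim (\<lambda>M. sqrt (real M) / t) at_top sequentially"
    using t by real_asymp
  from filterlim_compose[OF gauss_limit_real this]
  have "(\<lambda>M. exp (t\<^sup>2 * ((sqrt (real M) / t)\<^sup>2 * ln (?g (sqrt (real M) / t))))) \<longlonglongrightarrow> exp (t\<^sup>2 * (-1))"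
    by (intro tendsto_intros)
  moreover have "eventually (\<lambda>M. exp (t\<^sup>2 * ((sqrt (real M) / t)\<^sup>2 * ln (?g (sqrt (real M) / t))))
     = (2 * exp (- t / sqrt (real M)) - exp (- 2 * t / sqrt (real M))) ^ M) sequentially"
    using eventually_gt_at_top[of 0]
  proof eventually_elim
    case (elim M)
    \<comment> \<open>For y = exp (- t / sqrt M) this yields 2 y - y^2 \<ge> y > 0, so the power can
      be expressed through \<open>ln\<close>.\<close>
    have "exp (- (2 * t / sqrt (real M))) \<le> exp (- (t / sqrt (real M)))"
      using t by (simp add: divide_right_mono)
    hence "0 < ?g (sqrt (real M) / t)"
      using exp_gt_zero[of "- (t / sqrt (real M))"] by (simp only: divide_divide_eq_right mult_1)
    hence "exp (real M * ln (?g (sqrt (real M) / t))) = ?g (sqrt (real M) / t) ^ M"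
      by (simp add: exp_of_nat_mult)
    moreover have "t\<^sup>2 * ((sqrt (real M) / t)\<^sup>2 * y) = real M * y" for y
      using t by (simp add: power_divide)
    moreover have "?g (sqrt (real M) / t) = 2 * exp (- t / sqrt (real M)) - exp (- 2 * t / sqrt (real M))"
      by simp
    ultimately show ?case by (simp only:)
  qed
  ultimately show ?thesis
    by (auto intro: Lim_transform_eventually)
qed simp

lemma qsep_poly_qdiff_iterate:
  fixes K :: nat
  assumes "qsep_poly q N p" "0 < q" "q < 1" "\<And>k. 0 < a k" "\<And>k. a k < 1"
  shows "\<exists>p'. qsep_poly q N p' \<and> (\<forall>n. coeff p' n = coeff p n * (\<Prod>k<K. (1 - a k * q ^ n) / (1 - a k)))"
proof (induction K)
  case 0
  show ?case using assms(1) by (intro exI[of _ p]) simp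
next
  case (Suc K)
  then obtain p' where p': "qsep_poly q N p'"
    "\<And>n. coeff p' n = coeff p n * (\<Prod>k<K. (1 - a k * q ^ n) / (1 - a k))" by blast
  show ?case
    using assms p' by (intro exI[of _ "qdiff_poly q (a K) p'"])
      (simp add: qsep_poly_qdiff coeff_qdiff_poly)
qed

text \<open>One round applies the operator with a = 1/2 and then substitutes q x; for y = q^n the
  multiplier is 2 (1 - y / 2) y = 1 - (1 - y)^2. As it has no term linear in 1 - y, a number of
  rounds proportional to 1 / (1 - q)^2 produces a Gaussian in n when q tends to 1.\<close>

lemma qsep_poly_gauss_iterate:
  assumes "qsep_poly q N p" "0 < q" "q < 1"
  shows "\<exists>p'. qsep_poly q N p' \<and> (\<forall>n. coeff p' n = coeff p n * (2 * q ^ n - q ^ (2 * n)) ^ K)"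
proof (induction K)
  case 0
  show ?case using assms(1) by (intro exI[of _ p]) simp
next
  case (Suc K)
  then obtain p' where p': "qsep_poly q N p'"
    "\<And>n. coeff p' n = coeff p n * (2 * q ^ n - q ^ (2 * n)) ^ K" by blast
  have "coeff (qdiff_poly q (1 / 2) p' \<circ>\<^sub>p [:0, q:]) n = coeff p' n * (2 * q ^ n - q ^ (2 * n))" for n
  proof -
    have "q ^ (2 * n) = q ^ n * q ^ n" by (simp add: mult_2 power_add)
    thus ?thesis by (simp add: coeff_pcompose_scale coeff_qdiff_poly left_diff_distrib)
  qed
  thus ?case
    using assms p' qsep_poly_scale[OF qsep_poly_qdiff[OF p'(1) assms(2,3), of "1 / 2"] assms(2)]
    by (intro exI[of _ "qdiff_poly q (1 / 2) p' \<circ>\<^sub>p [:0, q:]"]) (simp add: mult_ac)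
qed

section \<open>Euler's product and the q-shifted factorials\<close>

definition euler_poly :: "real \<Rightarrow> nat \<Rightarrow> real poly" where
  "euler_poly q N = (\<Prod>i<N. [:1, - (q ^ Suc i):])"

lemma qsep_poly_euler:
  assumes "0 < q"
  shows "qsep_poly q N (euler_poly q N)"
  unfolding qsep_poly_def euler_poly_def
  by (intro exI[of _ "\<lambda>i. 1 / q ^ Suc i"]) (use assms in \<open>simp add: field_simps\<close>)

lemma coeff_euler_poly_0: "coeff (euler_poly q N) 0 = 1"
proof -
  have "poly (euler_poly q N) 0 = 1" by (simp add: euler_poly_def poly_prod)
  thus ?thesis by (simp add: poly_0_coeff_0)
qed

text \<open>Splitting off the first or the last factor of the product with N + 1 factors gives P(q
  x) (1 - q x) = P(x) (1 - q^(N+1) x).\<close>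

lemma coeff_euler_poly_Suc:
  "coeff (euler_poly q N) (Suc n) * (1 - q ^ Suc n) = - (q ^ Suc n - q ^ Suc N) * coeff (euler_poly q N) n"
proof -
  let ?P = "euler_poly q N"
  have "(?P \<circ>\<^sub>p [:0, q:]) * [:1, - q:] = euler_poly q (Suc N)"
    by (simp add: euler_poly_def pcompose_prod pcompose_pCons prod.lessThan_Suc_shift mult_ac del: prod.lessThan_Suc)
  also have "\<dots> = ?P * [:1, - (q ^ Suc N):]"
    by (simp add: euler_poly_def)
  finally have "coeff ((?P \<circ>\<^sub>p [:0, q:]) * [:1, - q:]) (Suc n) = coeff (?P * [:1, - (q ^ Suc N):]) (Suc n)"
    by simp
  moreover have "coeff (r * [:1, - b:]) (Suc n) = coeff r (Suc n) - b * coeff r n" for r and b :: real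
    by (simp add: coeff_pCons)
  ultimately have "coeff ?P (Suc n) * q ^ Suc n - q * (coeff ?P n * q ^ n) = coeff ?P (Suc n) - q ^ Suc N * coeff ?P n"
    by (simp only: coeff_pcompose_scale)
  thus ?thesis by (simp add: algebra_simps)
qed

lemma qpoch_pos:
  assumes "0 < q" "q < 1" "0 < a" "a < 1"
  shows "0 < qpoch a q n"
proof -
  have "a * q ^ k < 1" for k
    using assms mult_less_le_imp_less[of a 1 "q ^ k" 1] by (simp add: power_le_one)
  thus ?thesis unfolding qpoch_def by (intro prod_pos) simp
qed

lemma coeff_euler_poly_limit:
  assumes "0 < q" "q < 1"
  shows "(\<lambda>N. coeff (euler_poly q N) n) \<longlonglongrightarrow> (-1) ^ n * (\<Prod>k<n. q ^ Suc k) / qpoch q q n"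
proof (induction n)
  case 0
  show ?case by (simp add: coeff_euler_poly_0 qpoch_def)
next
  case (Suc n)
  have "q ^ Suc n < 1" using assms by (intro power_Suc_less_one) auto
  hence *: "coeff (euler_poly q N) (Suc n) = - (q ^ Suc n - q ^ Suc N) / (1 - q ^ Suc n) * coeff (euler_poly q N) n" for N
    using coeff_euler_poly_Suc[of q N n] by (simp add: field_simps)
  have "(\<lambda>N. q ^ Suc N) \<longlonglongrightarrow> 0"
    using assms by (intro LIMSEQ_Suc LIMSEQ_realpow_zero) auto
  hence "(\<lambda>N. - (q ^ Suc n - q ^ Suc N) / (1 - q ^ Suc n) * coeff (euler_poly q N) n)
      \<longlonglongrightarrow> - (q ^ Suc n - 0) / (1 - q ^ Suc n) * ((-1) ^ n * (\<Prod>k<n. q ^ Suc k) / qpoch q q n)"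
    using \<open>q ^ Suc n < 1\<close> by (intro tendsto_intros Suc) auto
  thus ?case unfolding * by (simp add: qpoch_def mult_ac)
qed

text \<open>This is the multiplier of N operators with parameters a q^k. It telescopes: n numerators
  with shift N remain over the first n denominators, and these numerators tend to 1.\<close>

lemma qpoch_ratio_limit:
  assumes "0 < q" "q < 1" "0 < a" "a < 1"
  shows "(\<lambda>N. \<Prod>k<N. (1 - a * q ^ k * q ^ n) / (1 - a * q ^ k)) \<longlonglongrightarrow> 1 / qpoch a q n"
proof -
  have nz: "1 - a * q ^ k \<noteq> 0" for k
    using qpoch_pos[OF assms, of "Suc k"] by (auto simp: qpoch_def)
  have tel: "(\<Prod>k<N. (1 - a * q ^ k * q ^ n) / (1 - a * q ^ k)) = (\<Prod>k<n. 1 - a * q ^ k * q ^ N) / qpoch a q n" for N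
  proof (induction N)
    case 0
    show ?case using nz by (simp add: qpoch_def)
  next
    case (Suc N)
    have "(\<Prod>k<n. 1 - a * q ^ k * q ^ Suc N) * (1 - a * q ^ N) = (\<Prod>k<Suc n. 1 - a * q ^ k * q ^ N)"
      by (simp add: prod.lessThan_Suc_shift mult_ac del: prod.lessThan_Suc)
    also have "\<dots> = (\<Prod>k<n. 1 - a * q ^ k * q ^ N) * (1 - a * q ^ N * q ^ n)"
      by (simp add: mult_ac)
    finally have "(\<Prod>k<n. 1 - a * q ^ k * q ^ N) * ((1 - a * q ^ N * q ^ n) / (1 - a * q ^ N))
        = (\<Prod>k<n. 1 - a * q ^ k * q ^ Suc N)"
      using nz[of N] by (simp add: field_simps)
    with Suc show ?case by (simp only: prod.lessThan_Suc times_divide_eq_left)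
  qed
  have "(\<lambda>N. q ^ N) \<longlonglongrightarrow> 0"
    using assms by (intro LIMSEQ_realpow_zero) auto
  hence "(\<lambda>N. (\<Prod>k<n. 1 - a * q ^ k * q ^ N) / qpoch a q n) \<longlonglongrightarrow> (\<Prod>k<n. 1 - a * q ^ k * 0) / qpoch a q n"
    using qpoch_pos[OF assms, of n] by (intro tendsto_divide tendsto_prod tendsto_diff tendsto_mult tendsto_const) auto
  thus ?thesis unfolding tel by simp
qed

text \<open>Apply M e Gaussian rounds with Q = exp (- sqrt c / sqrt M), then the operator with a =
  Q. \<open>gauss_limit\<close> at t = n sqrt c gives the exponential, and 1 + Q + ... + Q^n tends
  to n + 1. Later e is 1 or 0, switching the Gaussian on or off.\<close>

lemma qsep_poly_gauss_deriv:
  assumes "qsep_poly q N p" and q: "0 < q" "q < 1" and "0 < c"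
  shows "nonneg_logderiv (Abs_fps (\<lambda>n. coeff p n * exp (- (c * (real n)\<^sup>2)) ^ e * real (Suc n)))"
proof -
  define Q where "Q M = exp (- sqrt c / sqrt (real M))" for M
  define f where "f M = Abs_fps (\<lambda>n. coeff p n * ((2 * Q M ^ n - Q M ^ (2 * n)) ^ M) ^ e *
     (\<Sum>i\<le>n. Q M ^ i))" for M
  have Q1: "Q \<longlonglongrightarrow> 1"
  proof -
    have "filterlim (\<lambda>M. sqrt (real M)) at_top sequentially"
      by (intro filterlim_compose[OF sqrt_at_top] filterlim_real_sequentially)
    hence "(\<lambda>M. exp (- sqrt c / sqrt (real M))) \<longlonglongrightarrow> exp 0"
      by (intro tendsto_exp real_tendsto_divide_at_top[OF tendsto_const])
    thus ?thesis by (simp add: Q_def [abs_def])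
  qed
  have "eventually (\<lambda>M. nonneg_logderiv (f M)) sequentially"
    using order_tendstoD(1)[OF Q1 \<open>q < 1\<close>] eventually_gt_at_top[of 0]
  proof eventually_elim
    case (elim M)
    have Q: "0 < Q M" "Q M < 1" using elim \<open>0 < c\<close> by (auto simp: Q_def)
    have "qsep_poly (Q M) N p"
      using qsep_poly_mono[OF assms(1)] elim by simp
    then obtain p' where p': "qsep_poly (Q M) N p'"
      "\<And>n. coeff p' n = coeff p n * (2 * Q M ^ n - Q M ^ (2 * n)) ^ (M * e)"
      using qsep_poly_gauss_iterate[of "Q M" N p "M * e"] Q by blast
    have "f M = fps_of_poly (qdiff_poly (Q M) (Q M) p')"
      using Q one_diff_power_eq[of "Q M"]
      by (intro fps_ext) (simp add: f_def coeff_qdiff_poly p'(2) power_mult one_diff_power_eq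
        lessThan_Suc_atMost flip: power_Suc)
    thus ?case
      using qsep_poly_nonneg_logderiv[OF qsep_poly_qdiff[OF p'(1) Q Q]] by simp
  qed
  thus ?thesis
  proof (rule nonneg_logderiv_limit)
    fix n
    have "2 * Q M ^ n - Q M ^ (2 * n) = 2 * exp (- (n * sqrt c) / sqrt (real M)) - exp (- 2 * (n * sqrt c) / sqrt (real M))" for M
      by (simp add: Q_def flip: exp_of_nat_mult)
    hence "(\<lambda>M. (2 * Q M ^ n - Q M ^ (2 * n)) ^ M) \<longlonglongrightarrow> exp (- (n * sqrt c)\<^sup>2)"
      using gauss_limit[of "n * sqrt c"] \<open>0 < c\<close> by simp
    moreover have "(real n * sqrt c)\<^sup>2 = c * (real n)\<^sup>2" using \<open>0 < c\<close> by (simp add: power_mult_distrib)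
    ultimately have "(\<lambda>M. fps_nth (f M) n) \<longlonglongrightarrow> coeff p n * exp (- (c * (real n)\<^sup>2)) ^ e * (\<Sum>i\<le>n. 1 ^ i)"
      unfolding f_def fps_nth_Abs_fps by (intro tendsto_intros Q1) simp
    thus "(\<lambda>M. fps_nth (f M) n) \<longlonglongrightarrow>
        fps_nth (Abs_fps (\<lambda>n. coeff p n * exp (- (c * (real n)\<^sup>2)) ^ e * real (Suc n))) n"
      by simp
  qed simp
qed

text \<open>The same N serves as degree of the Euler polynomial and as number of operators with
  parameters a q^k; substituting l x supplies \<open>l ^ n\<close>. Then N tends to
  infinity.\<close>

lemma nonneg_logderiv_qbessel:
  assumes q: "0 < q" "q < 1" and a: "0 < a" "a < 1" and "0 < c" "0 < l"
  shows "nonneg_logderiv (Abs_fps (\<lambda>n. (-1) ^ n * (\<Prod>k<n. q ^ Suc k) / qpoch q q n * (1 / qpoch a q n)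
           * l ^ n * exp (- (c * (real n)\<^sup>2)) ^ e * real (Suc n)))"
proof (rule nonneg_logderiv_limit)
  let ?f = "\<lambda>N. Abs_fps (\<lambda>n. coeff (euler_poly q N) n *
     (\<Prod>k<N. (1 - a * q ^ k * q ^ n) / (1 - a * q ^ k)) * l ^ n * exp (- (c * (real n)\<^sup>2)) ^ e * real (Suc n))"
  show "eventually (\<lambda>N. nonneg_logderiv (?f N)) sequentially"
  proof (rule always_eventually, rule allI)
    fix N
    have "0 < a * q ^ k \<and> a * q ^ k < 1" for k
      using q a mult_less_le_imp_less[of a 1 "q ^ k" 1] by (simp add: power_le_one)
    then obtain p where p: "qsep_poly q N p" "\<And>n. coeff p n = coeff (euler_poly q N) n *
        (\<Prod>k<N. (1 - a * q ^ k * q ^ n) / (1 - a * q ^ k))"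
      using qsep_poly_qdiff_iterate[OF qsep_poly_euler[OF q(1), of N] q, of "\<lambda>k. a * q ^ k" N] by blast
    show "nonneg_logderiv (?f N)"
      using qsep_poly_gauss_deriv[OF qsep_poly_scale[OF p(1) \<open>0 < l\<close>] q \<open>0 < c\<close>, of e]
      by (simp add: coeff_pcompose_scale p(2))
  qed
  show "(\<lambda>N. fps_nth (?f N) n) \<longlonglongrightarrow>
     fps_nth (Abs_fps (\<lambda>n. (-1) ^ n * (\<Prod>k<n. q ^ Suc k) / qpoch q q n * (1 / qpoch a q n)
           * l ^ n * exp (- (c * (real n)\<^sup>2)) ^ e * real (Suc n))) n" for n
    unfolding fps_nth_Abs_fps
    by (intro tendsto_intros coeff_euler_poly_limit qpoch_ratio_limit q a)
qed simp

subsection \<open>The critical radius of an entire function\<close>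

definition cfps :: "real fps \<Rightarrow> complex fps" where
  "cfps f = Abs_fps (\<lambda>n. of_real (fps_nth f n))"

lemma cfps_nth [simp]: "fps_nth (cfps f) n = of_real (fps_nth f n)"
  by (simp add: cfps_def)

lemma cfps_mult: "cfps (f * g) = cfps f * cfps g"
  by (rule fps_ext) (simp add: fps_mult_nth)

lemma cfps_deriv: "cfps (fps_deriv f) = fps_deriv (cfps f)"
  by (rule fps_ext) simp

lemma cfps_uminus: "cfps (- f) = - cfps f"
  by (rule fps_ext) simp

lemma fps_conv_radius_cfps: "fps_conv_radius (cfps f) = fps_conv_radius f"
  using fps_conv_radius_norm[of "cfps f"] fps_conv_radius_norm[of f] by simp

lemma eval_cfps_of_real:
  assumes "ereal \<bar>t\<bar> < fps_conv_radius f"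
  shows "eval_fps (cfps f) (of_real t) = of_real (eval_fps f t)"
proof -
  have "summable (\<lambda>n. fps_nth f n * t ^ n)"
    using assms by (intro summable_fps) simp
  from suminf_of_real[OF this, where ?'a = complex] show ?thesis
    by (simp add: eval_fps_def)
qed

lemma norm_eval_cfps_le:
  assumes "\<And>n. 0 \<le> fps_nth f n" "norm z < fps_conv_radius f"
  shows "norm (eval_fps (cfps f) z) \<le> eval_fps f (norm z)"
proof -
  have s: "summable (\<lambda>n. norm (fps_nth (cfps f) n * z ^ n))"
    using assms by (intro norm_summable_fps) (simp add: fps_conv_radius_cfps)
  have "norm (eval_fps (cfps f) z) \<le> (\<Sum>n. norm (fps_nth (cfps f) n * z ^ n))"
    unfolding eval_fps_def by (rule summable_norm [OF s])
  also have "\<dots> = eval_fps f (norm z)"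
    using assms by (simp add: eval_fps_def norm_mult norm_power)
  finally show ?thesis .
qed

lemma eval_fps_nonneg_mono:
  fixes f :: "real fps"
  assumes "\<And>n. 0 \<le> fps_nth f n" "0 \<le> s" "s \<le> t" "t < fps_conv_radius f"
  shows "eval_fps f s \<le> eval_fps f t"
  unfolding eval_fps_def
proof (rule suminf_le)
  have "ereal \<bar>s\<bar> \<le> ereal t" using assms by simp
  hence "ereal \<bar>s\<bar> < fps_conv_radius f" using assms(4) by (rule le_less_trans)
  thus "summable (\<lambda>n. fps_nth f n * s ^ n)" by (intro summable_fps) simp
  show "summable (\<lambda>n. fps_nth f n * t ^ n)" using assms by (intro summable_fps) simp
qed (use assms in \<open>auto intro!: mult_left_mono power_mono\<close>)

text \<open>Take \<rho> as the distance from 0 to the closed zero set, which is attained, or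
  infinity if there is no zero.\<close>

lemma zero_free_disc:
  fixes F :: "complex \<Rightarrow> complex"
  assumes cont: "continuous_on UNIV F" and "F 0 \<noteq> 0"
  obtains \<rho> :: ereal where "0 < \<rho>" "\<And>z. norm z < \<rho> \<Longrightarrow> F z \<noteq> 0"
    "\<rho> = \<infinity> \<or> (\<exists>z. F z = 0 \<and> \<rho> = norm z)"
proof (cases "\<exists>z. F z = 0")
  case True
  let ?Z = "F -` {0}"
  have "closed ?Z" using cont by (intro closed_vimage) auto
  moreover have "?Z \<noteq> {}" using True by auto
  ultimately obtain z where z: "z \<in> ?Z" "\<And>w. w \<in> ?Z \<Longrightarrow> dist 0 z \<le> dist 0 w"
    using distance_attains_inf[of ?Z 0] by blast
  show ?thesis
  proof (rule that[of "norm z"])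
    show "0 < ereal (norm z)" using z(1) assms(2) by auto
    show "\<And>w. ereal (norm w) < ereal (norm z) \<Longrightarrow> F w \<noteq> 0" using z(2) by force
  qed (use z in auto)
qed (use that[of \<infinity>] in auto)

text \<open>The condition \<open>nontrivial\<close> makes the constant coefficient of -F'/F
  positive; hence t S(t) grows strictly, and without bound if F has no zero.\<close>

locale entire_nonneg_logderiv =
  fixes f :: "real fps"
  assumes logderiv: "nonneg_logderiv f"
    and entire: "fps_conv_radius f = \<infinity>"
    and nontrivial: "fps_nth f 1 < 0"
begin

definition F :: "complex \<Rightarrow> complex" where "F = eval_fps (cfps f)"
definition F' :: "complex \<Rightarrow> complex" where "F' = eval_fps (fps_deriv (cfps f))"
definition S :: "real \<Rightarrow> real" where "S = eval_fps (neg_logderiv f)"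

lemma f0: "fps_nth f 0 = 1"
  using logderiv by (simp add: nonneg_logderiv_def)

lemma S_coeff: "0 \<le> fps_nth (neg_logderiv f) n"
  using logderiv by (simp add: nonneg_logderiv_def)

lemma S_coeff_0: "0 < fps_nth (neg_logderiv f) 0"
  using nontrivial f0 by (simp add: neg_logderiv_nth)

lemma radius: "fps_conv_radius (cfps f) = \<infinity>" "fps_conv_radius (fps_deriv (cfps f)) = \<infinity>"
  using fps_conv_radius_deriv[of "cfps f"] entire by (auto simp: fps_conv_radius_cfps)

lemma F_0: "F 0 = 1"
  by (simp add: F_def eval_fps_at_0 f0)

lemma F_deriv: "(F has_field_derivative F' z) (at z within A)"
  unfolding F_def F'_def by (intro has_field_derivative_eval_fps) (simp add: radius)

lemma F_cont: "continuous_on UNIV F"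
  by (intro continuous_at_imp_continuous_on) (meson F_deriv DERIV_isCont)

context
  fixes \<rho> :: ereal
  assumes \<rho>_pos: "0 < \<rho>" and zero_free: "\<And>z. norm z < \<rho> \<Longrightarrow> F z \<noteq> 0"
begin

text \<open>F has no zero in the disc of radius \<rho>, so 1/F expands there, and -F'/F is its
  product with an entire series.\<close>

lemma radius_S: "\<rho> \<le> fps_conv_radius (neg_logderiv f)"
proof -
  have "cfps (neg_logderiv f) * cfps f = - fps_deriv (cfps f)"
    using neg_logderiv_mult_self[OF f0] by (metis cfps_mult cfps_uminus cfps_deriv)
  hence "cfps (neg_logderiv f) * (cfps f * inverse (cfps f)) = - fps_deriv (cfps f) * inverse (cfps f)"
    by (simp add: mult.assoc [symmetric])
  hence "cfps (neg_logderiv f) = - fps_deriv (cfps f) * inverse (cfps f)"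
    using f0 by (simp add: inverse_mult_eq_1')
  moreover have "\<rho> \<le> fps_conv_radius (inverse (cfps f))"
    using fps_conv_radius_inverse[of \<rho> "cfps f"] zero_free radius by (simp add: F_def)
  ultimately show ?thesis
    using fps_conv_radius_mult[of "- fps_deriv (cfps f)" "inverse (cfps f)"] radius
    by (simp flip: fps_conv_radius_cfps[of "neg_logderiv f"])
qed

lemma F'_eq:
  assumes "norm z < \<rho>"
  shows "F' z = - eval_fps (cfps (neg_logderiv f)) z * F z"
proof -
  have "cfps (neg_logderiv f) * cfps f = - fps_deriv (cfps f)"
    using neg_logderiv_mult_self[OF f0] by (metis cfps_mult cfps_uminus cfps_deriv)
  moreover have "ereal (norm z) < fps_conv_radius (cfps (neg_logderiv f))"
    using less_le_trans[OF assms radius_S] by (simp add: fps_conv_radius_cfps)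
  ultimately have "eval_fps (cfps (neg_logderiv f)) z * F z = - F' z"
    using radius by (simp add: F_def F'_def flip: eval_fps_mult eval_fps_minus)
  thus ?thesis by simp
qed

lemma norm_L_le:
  assumes "norm z < \<rho>"
  shows "norm (eval_fps (cfps (neg_logderiv f)) z) \<le> S (norm z)"
  unfolding S_def using less_le_trans[OF assms radius_S] S_coeff by (intro norm_eval_cfps_le)

lemma S_mono:
  assumes "0 \<le> s" "s \<le> t" "t < \<rho>"
  shows "S s \<le> S t"
  unfolding S_def using less_le_trans[OF assms(3) radius_S] S_coeff assms
  by (intro eval_fps_nonneg_mono)

lemma S_pos:
  assumes "0 \<le> t" "t < \<rho>"
  shows "fps_nth (neg_logderiv f) 0 \<le> S t"
  using S_mono[of 0 t] assms by (simp add: S_def eval_fps_at_0)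

lemma u_strict_mono:
  assumes "0 \<le> s" "s < t" "t < \<rho>"
  shows "s * S s < t * S t"
proof -
  have "s * S s \<le> s * S t" using assms by (intro mult_left_mono S_mono) auto
  also have "0 < S t" using S_pos[of t] S_coeff_0 assms by simp
  hence "s * S t < t * S t" using assms by simp
  finally show ?thesis .
qed

lemma u_cont:
  assumes "t < \<rho>"
  shows "continuous_on {0..t} (\<lambda>x. x * S x)"
  unfolding S_def
proof (intro continuous_intros subsetI)
  fix x assume "x \<in> (\<lambda>x. x) ` {0..t}"
  hence "ereal \<bar>x\<bar> \<le> ereal t" by simp
  also note assms
  also note radius_S
  finally show "x \<in> eball 0 (fps_conv_radius (neg_logderiv f))" by simp
qed

text \<open>Where F does not vanish, this turns the equation into t S(t) = 1/2.\<close>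

lemma F_of_real:
  assumes "0 \<le> t" "t < \<rho>"
  shows "F (of_real t) + of_real (2 * t) * F' (of_real t) = F (of_real t) * of_real (1 - 2 * (t * S t))"
proof -
  have "ereal \<bar>t\<bar> < \<rho>" using assms by simp
  from less_le_trans[OF this radius_S]
  have "eval_fps (cfps (neg_logderiv f)) (of_real t) = of_real (S t)"
    unfolding S_def by (rule eval_cfps_of_real)
  thus ?thesis using F'_eq[of "of_real t"] assms by (simp add: algebra_simps)
qed

text \<open>If g is a primitive of -F'/F, then F exp g is constant, so F(z) = exp (g(0) - g(z)). On
  the closed disc through z the derivative of g is bounded by S(|z|).\<close>

lemma norm_F_ge:
  assumes "norm z < \<rho>"
  shows "exp (- (norm z * S (norm z))) \<le> norm (F z)"
proof -
  let ?L = "eval_fps (cfps (neg_logderiv f))"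
  have conv: "convex (eball (0 :: complex) \<rho>)" by (cases \<rho>) auto
  have "?L holomorphic_on eball 0 \<rho>"
    using radius_S by (intro holomorphic_on_eval_fps eball_mono) (simp add: fps_conv_radius_cfps)
  then obtain g where g: "\<And>x. x \<in> eball 0 \<rho> \<Longrightarrow> (g has_field_derivative ?L x) (at x within eball 0 \<rho>)"
    using holomorphic_convex_primitive'[OF conv] by blast
  have "((\<lambda>x. F x * exp (g x)) has_field_derivative 0) (at x within eball 0 \<rho>)" if "x \<in> eball 0 \<rho>" for x
  proof -
    have "((\<lambda>x. F x * exp (g x)) has_field_derivative F' x * exp (g x) + exp (g x) * ?L x * F x)
        (at x within eball 0 \<rho>)"
      by (rule DERIV_mult[OF F_deriv DERIV_chain2[OF DERIV_exp g[OF that]]])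
    moreover have "F' x * exp (g x) + exp (g x) * ?L x * F x = 0"
    proof -
      have "ereal (norm x) < \<rho>" using that by simp
      hence "F' x = - ?L x * F x" by (rule F'_eq)
      moreover have "- l * a * e + e * l * a = 0" for l a e :: complex by (simp add: mult_ac)
      ultimately show ?thesis by (simp only:)
    qed
    ultimately show ?thesis by (simp only:)
  qed
  hence "\<exists>c. \<forall>x\<in>eball 0 \<rho>. F x * exp (g x) = c"
    by (intro has_field_derivative_zero_constant[OF conv])
  then obtain c where c: "\<And>x. x \<in> eball 0 \<rho> \<Longrightarrow> F x * exp (g x) = c"
    by blast
  have "c = exp (g 0)" using c[of 0] \<rho>_pos by (simp add: F_0 zero_ereal_def)
  hence Fz: "F z = exp (g 0 - g z)"
    using c[of z] assms by (simp add: exp_diff field_simps)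
  have sub: "w \<in> eball 0 \<rho> \<and> norm w \<le> norm z" if "w \<in> cball 0 (norm z)" for w :: complex
    using that le_less_trans[of "ereal (norm w)" "ereal (norm z)" \<rho>] assms by simp
  have "norm (g 0 - g z) \<le> S (norm z) * norm (0 - z)"
  proof (rule field_differentiable_bound[of "cball 0 (norm z)"])
    fix w :: complex assume w: "w \<in> cball 0 (norm z)"
    show "(g has_field_derivative ?L w) (at w within cball 0 (norm z))"
      using sub w by (intro has_field_derivative_subset[OF g]) auto
    have "norm (?L w) \<le> S (norm w)" using sub[OF w] by (intro norm_L_le) simp
    also have "\<dots> \<le> S (norm z)" using sub[OF w] assms by (intro S_mono) auto
    finally show "norm (?L w) \<le> S (norm z)" .
  qed auto
  hence "- (norm z * S (norm z)) \<le> Re (g 0 - g z)"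
    using abs_Re_le_cmod[of "g 0 - g z"] by (simp add: mult.commute)
  thus ?thesis by (simp add: Fz)
qed

text \<open>Suppose t S(t) stays below 1/2. Then \<rho> is finite, because S is bounded below by a
  positive constant. But \<open>norm_F_ge\<close> keeps |F| above exp (-1/2) on the segment to a
  nearest zero, against continuity.\<close>

lemma u_attains_half:
  assumes "\<rho> = \<infinity> \<or> (\<exists>z. F z = 0 \<and> \<rho> = norm z)"
  shows "\<exists>t. 0 \<le> t \<and> t < \<rho> \<and> 1 / 2 \<le> t * S t"
proof (rule ccontr)
  assume "\<not> ?thesis"
  hence u: "t * S t < 1 / 2" if "0 \<le> t" "t < \<rho>" for t using that by force
  from assms show False
  proof
    assume "\<rho> = \<infinity>"
    let ?s = "fps_nth (neg_logderiv f) 0"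
    have "?s * (1 / ?s) \<le> S (1 / ?s) * (1 / ?s)"
      using S_coeff_0 S_pos[of "1 / ?s"] \<open>\<rho> = \<infinity>\<close> by (intro mult_right_mono) auto
    with u[of "1 / ?s"] S_coeff_0 \<open>\<rho> = \<infinity>\<close> show False by (simp add: field_simps)
  next
    assume "\<exists>z. F z = 0 \<and> \<rho> = norm z"
    then obtain z where z: "F z = 0" "\<rho> = norm z" by blast
    have "exp (- (1 / 2)) \<le> norm (F (of_real x * z))" if "0 < x" "x < 1" for x
    proof -
      have "norm (of_real x * z) < \<rho>" using that z \<rho>_pos by (simp add: norm_mult)
      hence "exp (- (norm (of_real x * z) * S (norm (of_real x * z)))) \<le> norm (F (of_real x * z))"
        by (intro norm_F_ge) simp
      moreover have "norm (of_real x * z) * S (norm (of_real x * z)) < 1 / 2"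
        using \<open>norm (of_real x * z) < \<rho>\<close> by (intro u) auto
      hence "exp (- (1 / 2)) \<le> exp (- (norm (of_real x * z) * S (norm (of_real x * z))))" by simp
      ultimately show ?thesis by linarith
    qed
    hence "eventually (\<lambda>x. exp (- (1 / 2)) \<le> norm (F (of_real x * z))) (at_left 1)"
      unfolding eventually_at_left_field by (intro exI[of _ 0]) auto
    moreover have "((\<lambda>x. norm (F (of_real x * z))) \<longlongrightarrow> norm (F (of_real 1 * z))) (at_left 1)"
      by (intro tendsto_norm isCont_tendsto_compose[of _ F] tendsto_intros)
         (use F_cont in \<open>simp add: continuous_on_eq_continuous_at\<close>)
    ultimately have "exp (- (1 / 2)) \<le> norm (F (of_real 1 * z))"
      by (intro tendsto_lowerbound) auto
    with z show False by simp
  qed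
qed

end

text \<open>The intermediate value theorem gives r with r S(r) = 1/2, and strict growth excludes
  smaller solutions.\<close>

theorem exists_critical_radius:
  "\<exists>r>0. F (of_real r) + of_real (2 * r) * F' (of_real r) = 0
    \<and> (\<forall>t. 0 < t \<and> t < r \<longrightarrow> F (of_real t) + of_real (2 * t) * F' (of_real t) \<noteq> 0)
    \<and> F (of_real r) \<noteq> 0
    \<and> (\<forall>z\<in>ball 0 r. F z \<noteq> 0 \<and> norm (z * F' z / F z) < 1 / 2)"
proof -
  obtain \<rho> :: ereal where \<rho>: "0 < \<rho>" "\<And>z. norm z < \<rho> \<Longrightarrow> F z \<noteq> 0"
    "\<rho> = \<infinity> \<or> (\<exists>z. F z = 0 \<and> \<rho> = norm z)"
    using zero_free_disc[OF F_cont] F_0 by auto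
  obtain t where t: "0 \<le> t" "t < \<rho>" "1 / 2 \<le> t * S t"
    using u_attains_half[OF \<rho>] by blast
  obtain r where r: "0 \<le> r" "r \<le> t" "r * S r = 1 / 2"
    using IVT'[of "\<lambda>x. x * S x" 0 "1 / 2" t] u_cont[OF \<rho>(1,2) t(2)] t by auto
  have "r \<noteq> 0" using r(3) by auto
  with r have "r > 0" by simp
  have r\<rho>: "r < \<rho>" using r t le_less_trans[of "ereal r" "ereal t" \<rho>] by simp
  have below: "ereal s < \<rho>" if "s \<le> r" for s
    using that r\<rho> le_less_trans[of "ereal s" "ereal r" \<rho>] by simp
  have u: "s * S s < 1 / 2" if "0 \<le> s" "s < r" for s
    using u_strict_mono[OF \<rho>(1,2) _ _ r\<rho>, of s] that r(3) by simp
  show ?thesis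
  proof (intro exI[of _ r] conjI allI impI ballI)
    show "F (of_real r) + of_real (2 * r) * F' (of_real r) = 0"
      using F_of_real[OF \<rho>(1,2) r(1) r\<rho>] r(3) by simp
    show "F (of_real r) \<noteq> 0" using \<rho>(2)[of "of_real r"] r(1) r\<rho> by simp
  next
    fix s assume s: "0 < s \<and> s < r"
    have "F (of_real s) \<noteq> 0" using \<rho>(2)[of "of_real s"] s below[of s] by simp
    moreover have "of_real (1 - 2 * (s * S s)) \<noteq> (0 :: complex)"
      unfolding of_real_eq_0_iff using u[of s] s by simp
    ultimately show "F (of_real s) + of_real (2 * s) * F' (of_real s) \<noteq> 0"
      using F_of_real[OF \<rho>(1,2), of s] below[of s] s by (metis less_imp_le mult_eq_0_iff)
  next
    fix z :: complex assume z: "z \<in> ball 0 r"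
    hence zr: "norm z < r" by simp
    hence z\<rho>: "norm z < \<rho>" using below[of "norm z"] by simp
    show Fz: "F z \<noteq> 0" using \<rho>(2) z\<rho> .
    have "norm (z * F' z / F z) = norm z * norm (eval_fps (cfps (neg_logderiv f)) z)"
      using F'_eq[OF \<rho>(1,2) z\<rho>] Fz by (simp add: norm_mult norm_divide)
    also have "\<dots> \<le> norm z * S (norm z)"
      using norm_L_le[OF \<rho>(1,2) z\<rho>] by (intro mult_left_mono) auto
    also have "\<dots> < 1 / 2" using u zr by simp
    finally show "norm (z * F' z / F z) < 1 / 2" .
  qed (fact \<open>r > 0\<close>)
qed

end

subsection \<open>The q-Bessel functions\<close>

text \<open>The left side is x^(\<mu>+2) times the second derivative of w^(-\<mu>) J(w) = k h(w^2),
  which is k (2 h' + 4 w^2 h''). In the application \<mu> = \<nu> - 2. The right half-plane avoids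
  the branch cut of the power.\<close>

lemma powr_shift_ode:
  fixes h h1 h2 J :: "complex \<Rightarrow> complex" and k \<mu> :: complex
  assumes J: "\<And>w. Re w > 0 \<Longrightarrow> J w = k * w powr \<mu> * h (w\<^sup>2)"
    and h: "\<And>z. (h has_field_derivative h1 z) (at z)"
    and h1: "\<And>z. (h1 has_field_derivative h2 z) (at z)"
    and x: "Re x > 0"
  shows "\<mu> * (\<mu> + 1) * J x - 2 * \<mu> * x * deriv J x + x\<^sup>2 * deriv (deriv J) x
     = k * x powr \<mu> * (2 * x\<^sup>2) * (h1 (x\<^sup>2) + 2 * x\<^sup>2 * h2 (x\<^sup>2))"
proof -
  let ?S = "{w :: complex. Re w > 0}"
  have "open ?S" by (rule open_halfspace_Re_gt)
  define J1 where "J1 w = k * w powr \<mu> * (\<mu> / w * h (w\<^sup>2) + 2 * w * h1 (w\<^sup>2))" for w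
  have nz: "w \<noteq> 0" if "w \<in> ?S" for w using that by auto
  have D[derivative_intros]: "((\<lambda>w. w powr \<mu>) has_field_derivative w powr \<mu> * (\<mu> / w)) (at w)" if "w \<in> ?S" for w
  proof -
    have "w \<notin> \<real>\<^sub>\<le>\<^sub>0" using that by (auto simp: complex_nonpos_Reals_iff)
    from has_field_derivative_powr[OF this, of \<mu>] show ?thesis
      using nz[OF that] by (simp add: powr_diff mult_ac)
  qed
  have H: "((\<lambda>w. h (w\<^sup>2)) has_field_derivative h1 (w\<^sup>2) * (2 * w)) (at w)" for w
    by (rule DERIV_chain2[OF h]) (auto intro!: derivative_eq_intros)
  have H1: "((\<lambda>w. h1 (w\<^sup>2)) has_field_derivative h2 (w\<^sup>2) * (2 * w)) (at w)" for w
    by (rule DERIV_chain2[OF h1]) (auto intro!: derivative_eq_intros)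
  have DJ: "(J has_field_derivative J1 w) (at w)" if "w \<in> ?S" for w
  proof -
    have "((\<lambda>w. k * w powr \<mu> * h (w\<^sup>2)) has_field_derivative J1 w) (at w)"
      unfolding J1_def
      by (rule derivative_eq_intros D H that refl)+ (simp add: algebra_simps)
    thus ?thesis
      by (rule has_field_derivative_transform_within_open[OF _ \<open>open ?S\<close> that]) (simp add: J)
  qed
  define J2 where "J2 w = k * (w powr \<mu> * (\<mu> / w)) * (\<mu> / w * h (w\<^sup>2) + 2 * w * h1 (w\<^sup>2))
     + (- \<mu> / w\<^sup>2 * h (w\<^sup>2) + h1 (w\<^sup>2) * (2 * w) * (\<mu> / w) + (2 * h1 (w\<^sup>2) + h2 (w\<^sup>2) * (2 * w) * (2 * w))) * (k * w powr \<mu>)" for w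
  have DJ1: "(J1 has_field_derivative J2 x) (at x)"
  proof -
    have I: "((\<lambda>w. \<mu> / w) has_field_derivative - \<mu> / x\<^sup>2) (at x)"
      using x by (auto intro!: derivative_eq_intros simp: power2_eq_square)
    have I2: "((\<lambda>w. 2 * w) has_field_derivative 2) (at x)"
      by (auto intro!: derivative_eq_intros)
    have "x \<in> ?S" using x by simp
    thus ?thesis unfolding J1_def J2_def
      by (intro DERIV_mult[OF DERIV_cmult[OF D] DERIV_add[OF DERIV_mult[OF I H] DERIV_mult[OF I2 H1]]])
  qed
  have dJ: "deriv J w = J1 w" if "w \<in> ?S" for w
    using DJ[OF that] by (rule DERIV_imp_deriv)
  have "(deriv J has_field_derivative J2 x) (at x)"
    by (rule has_field_derivative_transform_within_open[OF DJ1 \<open>open ?S\<close>])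
       (use x dJ in simp_all)
  hence d: "deriv J x = J1 x" "deriv (deriv J) x = J2 x"
    using dJ[of x] x by (auto intro: DERIV_imp_deriv)
  have "x \<noteq> 0" using x by auto
  \<comment> \<open>Replacing \<mu> by x y removes the divisions by x and leaves a polynomial
    identity.\<close>
  obtain y where y: "\<mu> = x * y"
    using \<open>x \<noteq> 0\<close> by (metis nonzero_mult_div_cancel_left times_divide_eq_right)
  have *: "\<mu> * (\<mu> + 1) * (k * p * a) - 2 * \<mu> * x * (k * p * (\<mu> / x * a + 2 * x * b))
     + x\<^sup>2 * (k * (p * (\<mu> / x)) * (\<mu> / x * a + 2 * x * b)
     + (- \<mu> / x\<^sup>2 * a + b * (2 * x) * (\<mu> / x) + (2 * b + c * (2 * x) * (2 * x))) * (k * p))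
    = k * p * (2 * x\<^sup>2) * (b + 2 * x\<^sup>2 * c)" for p a b c :: complex
  proof -
    have "\<mu> / x = y" "- \<mu> / x\<^sup>2 = - y / x" using \<open>x \<noteq> 0\<close> by (auto simp: y power2_eq_square)
    moreover have "x\<^sup>2 * (A + (- y / x * a + B) * C) = x\<^sup>2 * A + (- \<mu> * a + x\<^sup>2 * B) * C" for A B C
      using \<open>x \<noteq> 0\<close> by (simp add: y field_simps power2_eq_square)
    ultimately show ?thesis
      by (simp only: add.assoc) (simp add: y algebra_simps power2_eq_square)
  qed
  show ?thesis
    unfolding d J[OF x] J1_def J2_def by (rule *)
qed

section \<open>Convergence of the q-products and q-series\<close>

lemma qpoch_inf_nonzero:
  assumes "0 < q" "q < 1" "0 < a" "a < 1"
  shows "qpoch_inf a q \<noteq> 0"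
proof -
  have "summable (\<lambda>k. norm (- (a * q ^ k)))"
    using assms by (auto intro!: summable_mult summable_geometric simp: abs_mult power_abs)
  hence "convergent_prod (\<lambda>k. 1 + - (a * q ^ k))"
    by (intro abs_convergent_prod_imp_convergent_prod summable_imp_abs_convergent_prod) simp
  moreover have "1 + - (a * q ^ k) \<noteq> 0" for k
    using qpoch_pos[OF assms, of "Suc k"] by (auto simp: qpoch_def)
  ultimately show ?thesis
    unfolding qpoch_inf_def using prodinf_nonzero[of "\<lambda>k. 1 + - (a * q ^ k)"] by simp
qed

text \<open>Consecutive coefficients have a ratio of order q^(n+1), which tends to 0.\<close>

lemma conv_radius_qbessel:
  assumes q: "0 < q" "q < 1" and a: "0 < a" "a < 1" and "0 < l"
  shows "conv_radius (\<lambda>n. (\<Prod>k<n. q ^ Suc k) / qpoch q q n * (1 / qpoch a q n) * l ^ n) = \<infinity>"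
proof (rule conv_radius_ratio_limit_ereal)
  let ?f = "\<lambda>n. (\<Prod>k<n. q ^ Suc k) / qpoch q q n * (1 / qpoch a q n) * l ^ n"
  have pos: "0 < ?f n" for n
    using assms qpoch_pos[OF q q, of n] qpoch_pos[OF q a, of n] by (auto intro!: prod_pos mult_pos_pos divide_pos_pos)
  show "eventually (\<lambda>n. ?f n \<noteq> 0) sequentially"
    using pos by (intro always_eventually allI) (metis less_irrefl)
  have ratio: "norm (?f n) / norm (?f (Suc n)) = ((1 - q * q ^ n) * (1 - a * q ^ n) / l) * (1 / q) ^ Suc n" for n
  proof -
    have "1 - q * q ^ n > 0" "1 - a * q ^ n > 0"
      using qpoch_pos[OF q q, of "Suc n"] qpoch_pos[OF q a, of "Suc n"] qpoch_pos[OF q q, of n] qpoch_pos[OF q a, of n]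
      by (auto simp: qpoch_def zero_less_mult_iff)
    moreover have "?f (Suc n) = ?f n * (q ^ Suc n * l / ((1 - q * q ^ n) * (1 - a * q ^ n)))"
      by (simp add: qpoch_def mult_ac)
    ultimately show ?thesis
      using pos[of n] pos[of "Suc n"] q assms(5) qpoch_pos[OF q q, of n] qpoch_pos[OF q a, of n] by (simp only: real_norm_def abs_of_pos) (simp add: power_divide)
  qed
  have "(\<lambda>n. (1 - q * q ^ n) * (1 - a * q ^ n) / l) \<longlonglongrightarrow> (1 - q * 0) * (1 - a * 0) / l"
    using q \<open>0 < l\<close> by (intro tendsto_intros LIMSEQ_realpow_zero) auto
  moreover have "0 < (1 - q * 0) * (1 - a * 0) / l" using \<open>0 < l\<close> by simp
  moreover have "filterlim (\<lambda>n. (1 / q) ^ Suc n) at_top sequentially"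
    unfolding inverse_eq_divide[symmetric] power_inverse using q
    by (intro filterlim_inverse_at_top LIMSEQ_Suc LIMSEQ_realpow_zero) auto
  ultimately have "filterlim (\<lambda>n. ((1 - q * q ^ n) * (1 - a * q ^ n) / l) * (1 / q) ^ Suc n) at_top sequentially"
    by (rule filterlim_tendsto_pos_mult_at_top)
  thus "(\<lambda>n. ereal (norm (?f n) / norm (?f (Suc n)))) \<longlonglongrightarrow> \<infinity>"
    unfolding ratio tendsto_PInfty_eq_at_top .
qed

lemma conv_radius_infinity_dominated:
  fixes f :: "nat \<Rightarrow> real"
  assumes "conv_radius g = \<infinity>" "\<And>n. \<bar>f n\<bar> \<le> (g n :: real)"
  shows "conv_radius f = \<infinity>"
proof (rule conv_radius_inftyI'')
  fix z :: real
  have "summable (\<lambda>n. norm (g n * z ^ n))"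
    using assms(1) by (intro abs_summable_in_conv_radius) simp
  thus "summable (\<lambda>n. f n * z ^ n)"
  proof (rule summable_comparison_test')
    show "norm (f n * z ^ n) \<le> norm (g n * z ^ n)" if "0 \<le> n" for n
      using assms(2)[of n] by (auto simp: abs_mult intro!: mult_right_mono)
  qed
qed

text \<open>The factor 4^n comes from (w/2)^(2n); the remaining 2^(-\<nu>) is moved to
  \<open>bessel_scale\<close>.\<close>

definition qB :: "nat \<Rightarrow> real \<Rightarrow> real \<Rightarrow> nat \<Rightarrow> real" where
  "qB s \<nu> q n = (if s = 2 then q powr (real n * (real n + \<nu>)) / 4 ^ n else q powr (real n * (real n + 1) / 2))
     / (qpoch q q n * qpoch (q powr (\<nu> + 1)) q n)"

text \<open>This is g in h(z) = z g(z).\<close>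

definition qG :: "nat \<Rightarrow> real \<Rightarrow> real \<Rightarrow> real fps" where
  "qG s \<nu> q = Abs_fps (\<lambda>n. (-1) ^ n * qB s \<nu> q n)"

definition bessel_scale :: "nat \<Rightarrow> real \<Rightarrow> real \<Rightarrow> real" where
  "bessel_scale s \<nu> q =
     qpoch_inf (q powr (\<nu> + 1)) q / qpoch_inf q q * (if s = 2 then 2 powr (- \<nu>) else 1)"

context
  fixes q \<nu> :: real and s :: nat
  assumes q: "0 < q" "q < 1" and \<nu>: "\<nu> > -1"
begin

lemma q_powr_nu_unit_interval: "0 < q powr (\<nu> + 1)" "q powr (\<nu> + 1) < 1"
  using q \<nu> powr_less_mono'[of q 0 "\<nu> + 1"] by auto

lemma prod_q_powr: "(\<Prod>k<n. q ^ Suc k) = q powr (real n * (real n + 1) / 2)"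
proof (induction n)
  case (Suc n)
  have "q ^ Suc n = q powr real (Suc n)" using q by (simp add: powr_realpow del: power_Suc of_nat_Suc)
  with Suc show ?case by (simp add: field_simps flip: powr_add)
qed (use q in simp)

text \<open>For s = 2 the exponent splits as n (n + \<nu>) = n (n + 1) / 2 + (\<nu> - 1/2) n + n^2 /
  2, which gives the scale l and the Gaussian rate c = - ln q / 2 for
  \<open>nonneg_logderiv_qbessel\<close>.\<close>

lemma qB_eq:
  "qB s \<nu> q n = (\<Prod>k<n. q ^ Suc k) / qpoch q q n * (1 / qpoch (q powr (\<nu> + 1)) q n)
     * (if s = 2 then q powr (\<nu> - 1 / 2) / 4 else 1) ^ n
     * exp (- (- ln q / 2 * (real n)\<^sup>2)) ^ (if s = 2 then 1 else 0)"
proof (cases "s = 2")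
  case True
  have "exp (- (- ln q / 2 * (real n)\<^sup>2)) = q powr ((real n)\<^sup>2 / 2)"
    using q by (simp add: powr_def)
  moreover have "(q powr (\<nu> - 1 / 2)) ^ n = q powr ((\<nu> - 1 / 2) * real n)"
    using q by (simp add: powr_powr flip: powr_realpow)
  moreover have "q powr (real n * (real n + \<nu>)) =
      q powr (real n * (real n + 1) / 2) * q powr ((\<nu> - 1 / 2) * real n) * q powr ((real n)\<^sup>2 / 2)"
    by (simp add: algebra_simps power2_eq_square add_divide_distrib flip: powr_add)
  ultimately show ?thesis
    unfolding qB_def prod_q_powr using True by (simp add: power_divide)
qed (unfold qB_def prod_q_powr, simp)

lemma qB_pos: "0 < qB s \<nu> q n"
  using q qpoch_pos[OF q q, of n] qpoch_pos[OF q q_powr_nu_unit_interval, of n] by (simp add: qB_def)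

lemma qG_conv_radius: "fps_conv_radius (qG s \<nu> q) = \<infinity>"
proof -
  let ?l = "if s = 2 then q powr (\<nu> - 1 / 2) / 4 else 1"
  let ?g = "\<lambda>n. (\<Prod>k<n. q ^ Suc k) / qpoch q q n * (1 / qpoch (q powr (\<nu> + 1)) q n) * ?l ^ n"
  have "conv_radius ?g = \<infinity>"
    using q by (intro conv_radius_qbessel q q_powr_nu_unit_interval) auto
  moreover have "\<bar>fps_nth (qG s \<nu> q) n\<bar> \<le> ?g n" for n
  proof -
    have g: "0 \<le> ?g n"
      using q qpoch_pos[OF q q, of n] qpoch_pos[OF q q_powr_nu_unit_interval, of n]
      by (intro mult_nonneg_nonneg divide_nonneg_nonneg prod_nonneg) auto
    \<comment> \<open>As ln q < 0, the Gaussian is at most 1, so the series without it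
      dominates.\<close>
    have e: "exp (- (- ln q / 2 * (real n)\<^sup>2)) ^ (if s = 2 then 1 else 0) \<le> 1"
      using q by (auto simp: mult_nonpos_nonneg)
    have "\<bar>fps_nth (qG s \<nu> q) n\<bar> = qB s \<nu> q n"
      using qB_pos[of n] by (simp add: qG_def abs_mult)
    also have "\<dots> \<le> ?g n"
      unfolding qB_eq using mult_left_mono[OF e g] by simp
    finally show ?thesis .
  qed
  ultimately show ?thesis
    unfolding fps_conv_radius_def by (rule conv_radius_infinity_dominated)
qed

lemma entire_nonneg_logderiv_qh: "entire_nonneg_logderiv (fps_deriv (fps_X * qG s \<nu> q))"
proof
  let ?l = "if s = 2 then q powr (\<nu> - 1 / 2) / 4 else 1"
  let ?c = "- ln q / 2"
  have "fps_deriv (fps_X * qG s \<nu> q) = Abs_fps (\<lambda>n. (-1) ^ n * (\<Prod>k<n. q ^ Suc k) / qpoch q q n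
      * (1 / qpoch (q powr (\<nu> + 1)) q n) * ?l ^ n * exp (- (?c * (real n)\<^sup>2)) ^ (if s = 2 then 1 else 0) * real (Suc n))"
  proof (rule fps_ext)
    fix n
    have "fps_nth (fps_deriv (fps_X * qG s \<nu> q)) n = real (Suc n) * ((-1) ^ n * qB s \<nu> q n)"
      by (simp add: qG_def algebra_simps)
    thus "fps_nth (fps_deriv (fps_X * qG s \<nu> q)) n = fps_nth (Abs_fps (\<lambda>n. (-1) ^ n * (\<Prod>k<n. q ^ Suc k) / qpoch q q n
      * (1 / qpoch (q powr (\<nu> + 1)) q n) * ?l ^ n * exp (- (?c * (real n)\<^sup>2)) ^ (if s = 2 then 1 else 0) * real (Suc n))) n"
      unfolding fps_nth_Abs_fps qB_eq by (simp only: mult_ac times_divide_eq_right times_divide_eq_left mult_1)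
  qed
  thus "nonneg_logderiv (fps_deriv (fps_X * qG s \<nu> q))"
    using q by (simp only:) (intro nonneg_logderiv_qbessel q q_powr_nu_unit_interval, auto)
  show "fps_conv_radius (fps_deriv (fps_X * qG s \<nu> q)) = \<infinity>"
    using fps_conv_radius_deriv[of "fps_X * qG s \<nu> q"] fps_conv_radius_mult[of fps_X "qG s \<nu> q"]
    by (simp add: qG_conv_radius)
  show "fps_nth (fps_deriv (fps_X * qG s \<nu> q)) 1 < 0"
    using qB_pos[of 1] by (simp add: qG_def)
qed

lemma bessel_scale_nonzero: "bessel_scale s \<nu> q \<noteq> 0"
  using qpoch_inf_nonzero[OF q q] qpoch_inf_nonzero[OF q q_powr_nu_unit_interval] by (simp add: bessel_scale_def)

lemma bessel_scale_qc: "(if s = 2 then 2 powr \<nu> else 1) * qc \<nu> q * bessel_scale s \<nu> q = 1"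
proof -
  have "(2 :: real) powr \<nu> * 2 powr (- \<nu>) = 1" by (simp flip: powr_add)
  thus ?thesis
    using qpoch_inf_nonzero[OF q q] qpoch_inf_nonzero[OF q q_powr_nu_unit_interval] by (simp add: bessel_scale_def qc_def)
qed

lemma powr_even_shift:
  fixes w :: complex
  assumes "w \<noteq> 0"
  shows "w powr of_real (2 * real n + \<nu>) = w powr of_real \<nu> * (w\<^sup>2) ^ n"
proof -
  have "w powr of_real (2 * real n + \<nu>) = w powr (of_nat (2 * n) + of_real \<nu>)" by simp
  also have "\<dots> = w powr of_nat (2 * n) * w powr of_real \<nu>" by (rule powr_add)
  also have "w powr of_nat (2 * n) = w ^ (2 * n)" using assms by (rule powr_nat'[OF disjI1])
  finally show ?thesis by (simp add: power_mult)
qed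

lemma qJ_eq:
  assumes s: "s \<in> {2, 3}" and w: "w \<noteq> 0"
  shows "qJ s \<nu> q w = of_real (bessel_scale s \<nu> q) * w powr of_real \<nu> * eval_fps (cfps (qG s \<nu> q)) (w\<^sup>2)"
proof -
  let ?G = "cfps (qG s \<nu> q)"
  have sm: "summable (\<lambda>n. fps_nth ?G n * (w\<^sup>2) ^ n)"
    by (intro summable_fps) (simp add: fps_conv_radius_cfps qG_conv_radius)
  show ?thesis
  proof (cases "s = 2")
    case True
    \<comment> \<open>Dividing by the positive number 2 does not change the branch of the
      power.\<close>
    have "w powr of_real \<nu> / of_real (2 powr \<nu>) = (w / 2) powr of_real \<nu>"
    proof -
      have "w powr of_real \<nu> = (of_real 2 * (w / 2)) powr of_real \<nu>" by simp
      also have "\<dots> = of_real 2 powr of_real \<nu> * (w / 2) powr of_real \<nu>"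
        by (rule powr_times_real_left) auto
      also have "of_real 2 powr of_real \<nu> = complex_of_real (2 powr \<nu>)"
        by (rule powr_of_real) simp
      finally show ?thesis by simp
    qed
    hence half: "(w / 2) powr of_real \<nu> = of_real (2 powr (- \<nu>)) * w powr of_real \<nu>"
      by (simp add: powr_minus field_simps)
    have summand: "(-1) ^ n * (w / 2) powr of_real (2 * real n + \<nu>) *
        of_real (q powr (real n * (real n + \<nu>)) / (qpoch q q n * qpoch (q powr (\<nu> + 1)) q n))
        = (of_real (2 powr (- \<nu>)) * w powr of_real \<nu>) * (fps_nth ?G n * (w\<^sup>2) ^ n)" for n
      using w True by (subst powr_even_shift)
        (simp_all add: half qG_def qB_def power_divide)
    show ?thesis
      unfolding qJ_def jackson2_def if_P[OF True] summand suminf_mult[OF sm]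
      using True by (simp add: bessel_scale_def eval_fps_def)
  next
    case False
    have summand: "(-1) ^ n * w powr of_real (2 * real n + \<nu>) *
        of_real (q powr (real n * (real n + 1) / 2) / (qpoch q q n * qpoch (q powr (\<nu> + 1)) q n))
        = w powr of_real \<nu> * (fps_nth ?G n * (w\<^sup>2) ^ n)" for n
      using w False by (subst powr_even_shift) (simp_all add: qG_def qB_def)
    show ?thesis
      unfolding qJ_def jackson3_def if_not_P[OF False] summand suminf_mult[OF sm]
      using False by (simp add: bessel_scale_def eval_fps_def)
  qed
qed

lemma eval_X_qG: "eval_fps (cfps (fps_X * qG s \<nu> q)) z = z * eval_fps (cfps (qG s \<nu> q)) z"
proof -
  have "cfps fps_X = fps_X" by (rule fps_ext) simp
  thus ?thesis
    by (simp add: cfps_mult eval_fps_mult fps_conv_radius_cfps qG_conv_radius)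
qed

lemma qh_eq:
  assumes s: "s \<in> {2, 3}"
  shows "qh s \<nu> q = eval_fps (cfps (fps_X * qG s \<nu> q))"
proof
  fix z
  show "qh s \<nu> q z = eval_fps (cfps (fps_X * qG s \<nu> q)) z"
  \<comment> \<open>At z = 0 the value 0 of \<open>powr\<close> at base 0 agrees with h(0) =
    0.\<close>
  proof (cases "z = 0")
    case False
    have "csqrt z powr of_real \<nu> = exp (of_real \<nu> * (Ln z / 2))"
    proof -
      \<comment> \<open>Halving \<open>Ln z\<close> keeps the imaginary part in the principal range,
        so no branch jump occurs, even on the negative axis.\<close>
      have "- pi < Im (Ln z / 2)" "Im (Ln z / 2) \<le> pi"
        using mpi_less_Im_Ln[OF False] Im_Ln_le_pi[OF False] pi_gt_zero by (auto simp: field_simps)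
      hence "exp (Ln z / 2) powr of_real \<nu> = exp (Ln z / 2 * of_real \<nu>)"
        by (rule exp_powr_complex)
      thus ?thesis using False by (simp add: csqrt_exp_Ln mult.commute)
    qed
    also have "\<dots> = z powr of_real (\<nu> / 2)" using False by (simp add: powr_def)
    finally have "z powr of_real (1 - \<nu> / 2) * csqrt z powr of_real \<nu> = z powr (of_real (1 - \<nu> / 2) + of_real (\<nu> / 2))"
      by (simp only: powr_add)
    also have "of_real (1 - \<nu> / 2) + of_real (\<nu> / 2) = (1 :: complex)" by simp
    finally have z: "z powr of_real (1 - \<nu> / 2) * csqrt z powr of_real \<nu> = z"
      using False by simp
    have J: "qJ s \<nu> q (csqrt z) = of_real (bessel_scale s \<nu> q) * csqrt z powr of_real \<nu> * eval_fps (cfps (qG s \<nu> q)) z"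
      using qJ_eq[OF s, of "csqrt z"] False by simp
    have "qh s \<nu> q z = of_real ((if s = 2 then 2 powr \<nu> else 1) * qc \<nu> q * bessel_scale s \<nu> q) *
        (z powr of_real (1 - \<nu> / 2) * csqrt z powr of_real \<nu>) * eval_fps (cfps (qG s \<nu> q)) z"
      unfolding qh_def J by (simp add: mult_ac)
    thus ?thesis unfolding bessel_scale_qc z by (simp add: eval_X_qG)
  qed (simp add: qh_def eval_X_qG)
qed

end

text \<open>The ball of radius r is admissible. Any larger one contains the point r, where the
  quotient is -1/2 and both sides of the strict inequality are 1/2.\<close>

lemma radius_uc_eqI:
  assumes r: "0 < r" and hol: "f analytic_on ball 0 r"
    and inside: "\<And>z. z \<in> ball 0 r \<Longrightarrow> deriv f z \<noteq> 0 \<and> norm (z * deriv (deriv f) z / deriv f z) < 1 / 2"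
    and boundary: "deriv f (of_real r) \<noteq> 0" "deriv f (of_real r) + of_real (2 * r) * deriv (deriv f) (of_real r) = 0"
  shows "radius_uc f = ereal r"
  unfolding radius_uc_def
proof (rule Sup_eqI)
  fix y assume "y \<in> ereal ` {r. r > 0 \<and> f analytic_on ball 0 r \<and>
      (\<forall>z\<in>ball 0 r. deriv f z \<noteq> 0 \<and>
         cmod (z * deriv (deriv f) z / deriv f z) < Re (1 + z * deriv (deriv f) z / deriv f z))}"
  then obtain t where t: "y = ereal t" and uc: "\<And>z. z \<in> ball 0 t \<Longrightarrow>
      cmod (z * deriv (deriv f) z / deriv f z) < Re (1 + z * deriv (deriv f) z / deriv f z)"
    by blast
  show "y \<le> ereal r"
  proof (rule ccontr)
    assume "\<not> y \<le> ereal r"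
    hence "of_real r \<in> ball (0 :: complex) t" using t r by simp
    moreover have "2 * (of_real r * deriv (deriv f) (of_real r)) = - deriv f (of_real r)"
      using boundary(2) by (simp add: mult.assoc add_eq_0_iff2)
    hence "of_real r * deriv (deriv f) (of_real r) / deriv f (of_real r) = - 1 / 2"
      using boundary(1) by (simp add: field_simps)
    ultimately show False using uc[of "of_real r"] by simp
  qed
next
  fix y assume y: "\<And>u. u \<in> ereal ` {r. r > 0 \<and> f analytic_on ball 0 r \<and>
      (\<forall>z\<in>ball 0 r. deriv f z \<noteq> 0 \<and>
         cmod (z * deriv (deriv f) z / deriv f z) < Re (1 + z * deriv (deriv f) z / deriv f z))} \<Longrightarrow> u \<le> y"
  have "cmod w < Re (1 + w)" if "cmod w < 1 / 2" for w
    using that abs_Re_le_cmod[of w] by simp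
  thus "ereal r \<le> y" using r hol inside by (intro y imageI) auto
qed

theorem theorem2:
  fixes q \<nu> :: real and s :: nat
  assumes "0 < q" and "q < 1" and "\<nu> > -1" and "s \<in> {2, 3}"
  shows "\<exists>r>0.
     (of_real ((\<nu> - 1) * (\<nu> - 2)) * qJ s \<nu> q (of_real (sqrt r))
      + of_real ((4 - 2 * \<nu>) * sqrt r) * deriv (qJ s \<nu> q) (of_real (sqrt r))
      + of_real r * deriv (deriv (qJ s \<nu> q)) (of_real (sqrt r)) = 0)
   \<and> (\<forall>t. 0 < t \<and> t < r \<longrightarrow>
       of_real ((\<nu> - 1) * (\<nu> - 2)) * qJ s \<nu> q (of_real (sqrt t))
       + of_real ((4 - 2 * \<nu>) * sqrt t) * deriv (qJ s \<nu> q) (of_real (sqrt t))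
       + of_real t * deriv (deriv (qJ s \<nu> q)) (of_real (sqrt t)) \<noteq> 0)
   \<and> radius_uc (qh s \<nu> q) = ereal r"
proof -
  note p = assms(1-3)
  interpret entire_nonneg_logderiv "fps_deriv (fps_X * qG s \<nu> q)"
    by (rule entire_nonneg_logderiv_qh[OF p])
  let ?h = "eval_fps (cfps (fps_X * qG s \<nu> q))"
  have "fps_conv_radius (cfps (fps_X * qG s \<nu> q)) = \<infinity>"
    using fps_conv_radius_mult[of fps_X "qG s \<nu> q"] by (simp add: fps_conv_radius_cfps qG_conv_radius[OF p])
  hence h: "(?h has_field_derivative F z) (at z)" "?h analytic_on A" for z A
    unfolding F_def cfps_deriv by (auto intro!: has_field_derivative_eval_fps analytic_on_eval_fps)
  have dh: "deriv (qh s \<nu> q) = F" "deriv F = F'"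
    using DERIV_imp_deriv[OF h(1)] DERIV_imp_deriv[OF F_deriv] by (auto simp: qh_eq[OF p assms(4)])
  have hq: "qh s \<nu> q analytic_on A" for A
    using h(2) by (simp add: qh_eq[OF p assms(4)])
  have ode: "of_real ((\<nu> - 1) * (\<nu> - 2)) * qJ s \<nu> q (of_real (sqrt t))
       + of_real ((4 - 2 * \<nu>) * sqrt t) * deriv (qJ s \<nu> q) (of_real (sqrt t))
       + of_real t * deriv (deriv (qJ s \<nu> q)) (of_real (sqrt t))
     = of_real (bessel_scale s \<nu> q) * of_real (sqrt t) powr of_real (\<nu> - 2) * of_real (2 * t) * (F (of_real t) + of_real (2 * t) * F' (of_real t))"
    if "0 < t" for t
  proof -
    let ?\<mu> = "of_real (\<nu> - 2) :: complex"
    have J: "qJ s \<nu> q w = of_real (bessel_scale s \<nu> q) * w powr ?\<mu> * ?h (w\<^sup>2)" if "Re w > 0" for w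
    proof -
      have "w \<noteq> 0" using that by auto
      \<comment> \<open>The factor w^2 split off here is the z in h(z) = z g(z).\<close>
      have "w powr of_real \<nu> = w powr (?\<mu> + of_nat 2)" by simp
      also have "\<dots> = w powr ?\<mu> * w\<^sup>2"
        unfolding powr_add using \<open>w \<noteq> 0\<close> by (subst powr_nat') auto
      finally show ?thesis
        using qJ_eq[OF p assms(4) \<open>w \<noteq> 0\<close>] by (simp add: eval_X_qG[OF p])
    qed
    have "?\<mu> * (?\<mu> + 1) * qJ s \<nu> q (of_real (sqrt t)) - 2 * ?\<mu> * of_real (sqrt t) * deriv (qJ s \<nu> q) (of_real (sqrt t))
        + (of_real (sqrt t))\<^sup>2 * deriv (deriv (qJ s \<nu> q)) (of_real (sqrt t))
      = of_real (bessel_scale s \<nu> q) * of_real (sqrt t) powr ?\<mu> * (2 * (of_real (sqrt t))\<^sup>2) *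
        (F ((of_real (sqrt t))\<^sup>2) + 2 * (of_real (sqrt t))\<^sup>2 * F' ((of_real (sqrt t))\<^sup>2))"
      by (rule powr_shift_ode[OF J h(1) F_deriv]) (use that in simp_all)
    moreover have "(complex_of_real (sqrt t))\<^sup>2 = of_real t"
      using that by (simp flip: of_real_power)
    moreover have "?\<mu> * (?\<mu> + 1) = of_real ((\<nu> - 1) * (\<nu> - 2))" by (simp add: algebra_simps)
    moreover have "- (2 * ?\<mu> * of_real (sqrt t)) = of_real ((4 - 2 * \<nu>) * sqrt t)" by (simp add: algebra_simps)
    ultimately show ?thesis
      by (simp only: diff_conv_add_uminus mult_minus_left[symmetric]) simp
  qed
  \<comment> \<open>The factors in front of F + 2 t F' do not vanish for t > 0.\<close>
  have zero_iff: "of_real ((\<nu> - 1) * (\<nu> - 2)) * qJ s \<nu> q (of_real (sqrt t))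
       + of_real ((4 - 2 * \<nu>) * sqrt t) * deriv (qJ s \<nu> q) (of_real (sqrt t))
       + of_real t * deriv (deriv (qJ s \<nu> q)) (of_real (sqrt t)) = 0
     \<longleftrightarrow> F (of_real t) + of_real (2 * t) * F' (of_real t) = 0" if "0 < t" for t
    unfolding ode[OF that] using that bessel_scale_nonzero[OF p] by simp
  obtain r where r: "0 < r" "F (of_real r) + of_real (2 * r) * F' (of_real r) = 0"
    "\<And>t. 0 < t \<Longrightarrow> t < r \<Longrightarrow> F (of_real t) + of_real (2 * t) * F' (of_real t) \<noteq> 0"
    "F (of_real r) \<noteq> 0" "\<And>z. z \<in> ball 0 r \<Longrightarrow> F z \<noteq> 0 \<and> norm (z * F' z / F z) < 1 / 2"
    using exists_critical_radius by blast
  have "radius_uc (qh s \<nu> q) = ereal r"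
    by (rule radius_uc_eqI) (use r hq in \<open>simp_all only: dh simp_thms\<close>)
  thus ?thesis
    using r(1,2) by (intro exI[of _ r] conjI allI impI; simp only: zero_iff r(3) not_False_eq_True)
qed

end
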